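(* Fix $\epsilon>0$ and an integer $K\ge2$. Suppose that for each prime $p$ we are given a nonempty subset $\Omega_p\subset\mathbb{Z}/p\mathbb{Z}$ with $s_p\le C\,p^{\lambda_K-\epsilon}$ for all $p$, where $C$ depends only on $K$. Assume that for each $2\le k\le K$ there is a constant $C_k$ such that for every prime $p$ and every $\mathbf{h}=(h_1,\dots,h_{k-1})$ with $0,h_1,\dots,h_{k-1}$ distinct modulo $p$, $$N_k(\mathbf{h},\Omega_p)=r_p^k\,p\,(1+E),\qquad |E|\le C_k(1-r_p)p^{-\epsilon}.$$ Then for every $2\le k\le K$ and every compact $X\subset\{x\in\mathbb{R}^{k-1}:\ 0<x_1<x_2<\dots<x_{k-1}\}$, the $k$-level correlation satisfies $R_k(X,\Omega_q)=\operatorname{vol}(X)+o_{X,k}(1)$ as $s_q\to\infty$ along squarefree $q$.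
   Context: $s_p=p/|\Omega_p|$, $r_p=1/s_p$. For squarefree $q$, $\Omega_q\subset\mathbb{Z}/q\mathbb{Z}$ is defined by $x\in\Omega_q$ iff $x\bmod p\in\Omega_p$ for all primes $p\mid q$; $s_q=q/|\Omega_q|$. For a set $\Omega\subset\mathbb{Z}/q\mathbb{Z}$ and $\mathbf{h}\in\mathbb{Z}^{k-1}$ with $h_0=0$, $N_k(\mathbf{h},\Omega)=\#\{t\bmod q:\ t+h_i\in\Omega,\ 0\le i\le k-1\}$. The $k$-level correlation is $R_k(X,\Omega_q)=\frac{1}{|\Omega_q|}\sum_{\mathbf{h}\in s_qX\cap\mathbb{Z}^{k-1}}N_k(\mathbf{h},\Omega_q)$. The constants are $\lambda_2=(\sqrt{17}-3)/2$, $\lambda_3=1/3$ and $\lambda_k=1/(k-1)$ for $k\ge4$.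
   Formalization: The compact set X is additionally required to have boundary of volume zero (Jordan measurable); for arbitrary compact X the claim fails, e.g. for Ω_p = Z/pZ minus {0}, k = 2, and X of positive measure containing no rational point. *)

theory Defs
  imports "HOL-Analysis.Analysis" "HOL-Computational_Algebra.Computational_Algebra"
begin

text \<open>
  Residues modulo \<open>q\<close> are represented by the integers in \<open>{0..<int q}\<close>. A vector
  \<open>(v\<^sub>1, \<dots>, v\<^sub>k\<^sub>-\<^sub>1)\<close> is a function on \<open>{1..<k}\<close>; the update \<open>v(0 := 0)\<close> implements the
  convention \<open>v\<^sub>0 = 0\<close>.
\<close>

definition lam :: "nat \<Rightarrow> real" where
  "lam k = (if k = 2 then (sqrt 17 - 3) / 2 else if k = 3 then 1 / 3 else 1 / (real k - 1))"

definition spacing :: "nat \<Rightarrow> int set \<Rightarrow> real" where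
  "spacing q A = real q / real (card A)"

definition crt_set :: "(nat \<Rightarrow> int set) \<Rightarrow> nat \<Rightarrow> int set" where
  "crt_set \<Omega> q = {x \<in> {0..<int q}. \<forall>p. prime p \<and> p dvd q \<longrightarrow> x mod int p \<in> \<Omega> p}"

definition shift_count :: "nat \<Rightarrow> (nat \<Rightarrow> int) \<Rightarrow> nat \<Rightarrow> int set \<Rightarrow> nat" where
  "shift_count k h q A = card {t \<in> {0..<int q}. \<forall>i<k. (t + (h(0 := 0)) i) mod int q \<in> A}"

definition dilate_lattice_points :: "nat \<Rightarrow> real \<Rightarrow> (nat \<Rightarrow> real) set \<Rightarrow> (nat \<Rightarrow> int) set" where
  "dilate_lattice_points k s X =
     {h \<in> {1..<k} \<rightarrow>\<^sub>E UNIV. \<exists>x\<in>X. \<forall>i\<in>{1..<k}. real_of_int (h i) = s * x i}"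

definition correlation :: "nat \<Rightarrow> (nat \<Rightarrow> real) set \<Rightarrow> nat \<Rightarrow> int set \<Rightarrow> real" where
  "correlation k X q A =
     (1 / real (card A)) *
       (\<Sum>h\<in>dilate_lattice_points k (spacing q A) X. real (shift_count k h q A))"

definition real_space :: "nat \<Rightarrow> (nat \<Rightarrow> real) topology" where
  "real_space k = product_topology (\<lambda>_. euclideanreal) {1..<k}"

definition vol_measure :: "nat \<Rightarrow> (nat \<Rightarrow> real) measure" where
  "vol_measure k = (\<Pi>\<^sub>M i\<in>{1..<k}. lborel)"

definition ordered_cone :: "nat \<Rightarrow> (nat \<Rightarrow> real) set" where
  "ordered_cone k = {x \<in> {1..<k} \<rightarrow>\<^sub>E UNIV. strict_mono_on {..<k} (x(0 := 0))}"

text \<open>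
  The correlation counts lattice points in a dilate of \<open>X\<close> and compares their number with the
  volume of \<open>X\<close>, so \<open>X\<close> has to be Jordan measurable. Compactness alone does not suffice: the
  spacing is rational, so the correlation vanishes for a compact \<open>X\<close> of positive volume that
  contains no point with rational coordinates.
\<close>

definition jordan_null_frontier :: "nat \<Rightarrow> (nat \<Rightarrow> real) set \<Rightarrow> bool" where
  "jordan_null_frontier k X \<longleftrightarrow> emeasure (vol_measure k) (real_space k frontier_of X) = 0"

definition spacing_at_top :: "(nat \<Rightarrow> int set) \<Rightarrow> nat filter" where
  "spacing_at_top \<Omega> =
     inf (filtercomap (\<lambda>q. spacing q (crt_set \<Omega> q)) at_top) (principal {q. squarefree q})"

end

theory Submission
  imports Defs "HOL-Number_Theory.Cong"
begin

text \<open>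
  Write \<open>N\<^sub>k(h, \<Omega>\<^sub>p) = r\<^sub>p\<^sup>k p (1 + e\<^sub>p(h))\<close>. By the Chinese remainder theorem the correlation of a box \<open>Q\<close> is
  \<open>s\<^sup>1\<^sup>-\<^sup>k\<close> times the sum over the lattice points \<open>h\<close> of \<open>s Q\<close> of \<open>\<Prod>\<^sub>p\<^sub>|\<^sub>q (1 + e\<^sub>p(h))\<close>, which expands as a
  sum over the divisors \<open>d\<close> of \<open>q\<close>; the divisor \<open>1\<close> gives the volume. For \<open>1 < d \<le> s\<^sup>\<beta>\<close>
  one uses that \<open>e\<^sub>p\<close> has mean zero modulo \<open>p\<close>, so only the boundary of the box matters. For
  \<open>d > s\<^sup>\<beta>\<close> Rankin's trick leads to the sum of \<open>\<Prod>\<^sub>p\<^sub>|\<^sub>q (1 + p\<^sup>\<alpha> |e\<^sub>p(h)|)\<close>. If \<open>c\<close> of the points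
  \<open>0, h\<^sub>1, \<dots>, h\<^sub>k\<^sub>-\<^sub>1\<close> coincide modulo \<open>p\<close> with an earlier one, then \<open>1 + e\<^sub>p(h)\<close> is about \<open>s\<^sub>p\<^sup>c\<close>;
  charging one factor to each such point and summing over \<open>h\<^sub>k\<^sub>-\<^sub>1, \<dots>, h\<^sub>1\<close> in turn reduces the sum to
  \<open>\<Sum>\<^sub>n (\<Prod>\<^sub>p\<^sub>|\<^sub>n (1 + p\<^sup>\<alpha> (s\<^sub>p - 1)))\<^sup>k\<^sup>-\<^sup>1\<close>, which is \<open>O(s\<^sup>1\<^sup>+\<^sup>\<eta>)\<close> for every \<open>\<eta> > 0\<close> as soon as
  \<open>s\<^sub>p\<^sup>k\<^sup>-\<^sup>1 \<le> A p\<^sup>1\<^sup>-\<^sup>\<epsilon>\<close>. A Jordan measurable compact set is finally squeezed between unions of small cubes.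
\<close>

section \<open>Products over sets of primes\<close>

text \<open>Induction on \<open>c\<close>: \<open>s ^ Suc c - 1\<close> is
  \<open>(s - 1) + (s ^ c - 1) + (s - 1) * (s ^ c - 1)\<close>, and the product on the right carries
  its cross term with \<open>P ^ 2\<close> instead of \<open>P\<close>. This allows \<open>c\<close>
  coincidences modulo a prime to be charged by one factor each.\<close>

lemma power_dilate_le:
  fixes P s :: real
  assumes "P \<ge> 1" "s \<ge> 1"
  shows "1 + P * (s ^ c - 1) \<le> (1 + P * (s - 1)) ^ c"
proof (induction c)
  case (Suc c)
  have "P * (s - 1) * (s ^ c - 1) * 1 \<le> P * (s - 1) * (s ^ c - 1) * P"
    using assms by (intro mult_left_mono) (auto intro!: mult_nonneg_nonneg)
  then have "1 + P * (s ^ Suc c - 1) \<le> (1 + P * (s - 1)) * (1 + P * (s ^ c - 1))"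
    by (simp add: algebra_simps)
  also have "\<dots> \<le> (1 + P * (s - 1)) * (1 + P * (s - 1)) ^ c"
    using assms Suc.IH by (intro mult_left_mono) auto
  finally show ?case by simp
qed simp

lemma one_minus_inverse_le_ln:
  fixes s :: real
  assumes "s \<ge> 1"
  shows "1 - 1 / s \<le> ln s"
  using assms ln_le_minus_one[of "1 / s"] by (simp add: ln_div)

text \<open>With \<open>x = 1 + P * (s - 1)\<close>, factor \<open>x ^ m - 1\<close> by the
  geometric sum; \<open>x - 1\<close> equals \<open>P * s * (1 - 1 / s)\<close> and \<open>x\<close>
  is at most \<open>P * s\<close>. The logarithm is the form in which factors can later be compared
  with powers of the spacing.\<close>

lemma power_dilate_minus_one_le:
  fixes P s :: real
  assumes "P \<ge> 1" "s \<ge> 1"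
  shows "(1 + P * (s - 1)) ^ m - 1 \<le> real m * (P * s) ^ m * ln s"
proof (cases m)
  case (Suc n)
  let ?u = "1 + P * (s - 1)"
  have u: "1 \<le> ?u" "?u \<le> P * s"
    using assms by (auto simp: algebra_simps)
  have "?u ^ m - 1 = (?u - 1) * (\<Sum>i<m. ?u ^ i)"
    by (rule power_diff_1_eq)
  also have "\<dots> \<le> (P * (s - 1)) * (\<Sum>i<m. (P * s) ^ n)"
  proof (intro mult_mono sum_mono)
    fix i assume "i \<in> {..<m}"
    then have "?u ^ i \<le> ?u ^ n" using u Suc by (intro power_increasing) auto
    also have "\<dots> \<le> (P * s) ^ n" using u by (intro power_mono) auto
    finally show "?u ^ i \<le> (P * s) ^ n" .
  qed (use assms u in \<open>auto intro!: sum_nonneg\<close>)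
  also have "\<dots> = real m * (P * s) ^ m * (1 - 1 / s)"
    using Suc assms by (simp add: field_simps)
  also have "\<dots> \<le> real m * (P * s) ^ m * ln s"
    using assms one_minus_inverse_le_ln by (intro mult_left_mono) auto
  finally show ?thesis .
qed (use assms in simp)

text \<open>Beyond some \<open>n\<close> the coefficient of \<open>ln (\<sigma> p)\<close> is below
  \<open>\<eta>\<close>, so \<open>1 + x \<le> exp x\<close> bounds the factor by
  \<open>\<sigma> p powr \<eta>\<close>. The smaller primes, at most \<open>n\<close> in number,
  cost a bounded factor each, whatever \<open>S\<close> is.\<close>

lemma prod_slowly_growing:
  fixes \<sigma> :: "nat \<Rightarrow> real"
  assumes \<sigma>: "\<And>p. prime p \<Longrightarrow> 1 \<le> \<sigma> p \<and> \<sigma> p \<le> real p"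
    and A: "A \<ge> 0" and "\<gamma> > 0" and "\<eta> > 0"
  shows "\<exists>M\<ge>0. \<forall>S. finite S \<longrightarrow> (\<forall>p\<in>S. prime p) \<longrightarrow>
           (\<Prod>p\<in>S. 1 + A * real p powr (- \<gamma>) * ln (\<sigma> p)) \<le> M * (\<Prod>p\<in>S. \<sigma> p) powr \<eta>"
proof -
  have "((\<lambda>p. A * real p powr (- \<gamma>)) \<longlongrightarrow> A * 0) at_top"
    using \<open>\<gamma> > 0\<close> by (intro tendsto_intros tendsto_neg_powr filterlim_real_sequentially) auto
  then have "eventually (\<lambda>p. A * real p powr (- \<gamma>) < \<eta>) at_top"
    using \<open>\<eta> > 0\<close> by (auto dest: order_tendstoD)
  then obtain n where n: "\<And>p. p \<ge> n \<Longrightarrow> A * real p powr (- \<gamma>) < \<eta>"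
    by (auto simp: eventually_at_top_linorder)
  \<comment> \<open>\<open>B\<close> majorizes every factor with \<open>p < n\<close>, since there
    \<open>ln (\<sigma> p) \<le> \<sigma> p - 1 \<le> n\<close>.\<close>
  define B where "B = 1 + A * real n"
  have B: "B \<ge> 1" using A by (auto simp: B_def)
  have single: "1 + A * real p powr (- \<gamma>) * ln (\<sigma> p) \<le> (if p < n then B else 1) * \<sigma> p powr \<eta>"
    if "prime p" for p
  proof (cases "p < n")
    case True
    have p: "real p \<ge> 1" using prime_ge_1_nat[OF that] by simp
    have "ln (\<sigma> p) \<le> real n"
      using \<sigma>[OF that] ln_le_minus_one[of "\<sigma> p"] True by auto
    moreover have "real p powr (- \<gamma>) \<le> 1"
      using p \<open>\<gamma> > 0\<close> by (simp add: powr_le_one_le powr_mono[of "-\<gamma>" 0 "real p", simplified])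
    ultimately have "A * real p powr (- \<gamma>) * ln (\<sigma> p) \<le> A * 1 * real n"
      using A \<sigma>[OF that] by (intro mult_mono) auto
    then have "1 + A * real p powr (- \<gamma>) * ln (\<sigma> p) \<le> B * 1" by (simp add: B_def)
    also have "\<dots> \<le> B * \<sigma> p powr \<eta>"
      using B \<sigma>[OF that] \<open>\<eta> > 0\<close> by (intro mult_left_mono ge_one_powr_ge_zero) auto
    finally show ?thesis using True by simp
  next
    case False
    have "1 + A * real p powr (- \<gamma>) * ln (\<sigma> p) \<le> exp (A * real p powr (- \<gamma>) * ln (\<sigma> p))"
      by (rule exp_ge_add_one_self)
    also have "\<dots> \<le> exp (\<eta> * ln (\<sigma> p))"
      using n[of p] False \<sigma>[OF that] by (auto intro!: mult_right_mono)
    also have "\<dots> = \<sigma> p powr \<eta>" using \<sigma>[OF that] by (simp add: powr_def)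
    finally show ?thesis using False by simp
  qed
  show ?thesis
  proof (intro exI[of _ "B ^ n"] conjI allI impI)
    fix S :: "nat set" assume S: "finite S" "\<forall>p\<in>S. prime p"
    have "(\<Prod>p\<in>S. 1 + A * real p powr (- \<gamma>) * ln (\<sigma> p))
        \<le> (\<Prod>p\<in>S. (if p < n then B else 1) * \<sigma> p powr \<eta>)"
      using S single A \<sigma> by (intro prod_mono) (auto intro!: add_nonneg_nonneg mult_nonneg_nonneg)
    also have "\<dots> = (\<Prod>p\<in>S. if p < n then B else 1) * (\<Prod>p\<in>S. \<sigma> p) powr \<eta>"
      using S \<sigma> by (subst prod_powr_distrib) (force simp: prod.distrib)+
    also have "(\<Prod>p\<in>S. if p < n then B else 1) = B ^ card (S \<inter> {..<n})"
      using S by (simp add: prod.If_cases lessThan_def Collect_conj_eq[symmetric])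
    also have "\<dots> \<le> B ^ n"
      using B card_mono[of "{..<n}" "S \<inter> {..<n}"] by (intro power_increasing) auto
    finally show "(\<Prod>p\<in>S. 1 + A * real p powr (- \<gamma>) * ln (\<sigma> p)) \<le> B ^ n * (\<Prod>p\<in>S. \<sigma> p) powr \<eta>"
      by (simp add: mult_right_mono)
  qed (use B in simp)
qed

section \<open>Divisor sums of multiplicative weights\<close>

lemma prod_primes_dvd:
  fixes n :: nat
  assumes "finite T" "\<And>p. p \<in> T \<Longrightarrow> prime p" "\<And>p. p \<in> T \<Longrightarrow> p dvd n"
  shows "\<Prod>T dvd n"
  using assms
proof (induction T rule: finite_induct)
  case (insert p T)
  have "coprime p (\<Prod>T)"
    using insert by (intro prod_coprime_right primes_coprime) auto
  with insert show ?case by (auto intro: divides_mult)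
qed simp

lemma card_multiples_le:
  fixes d L :: nat
  assumes "d > 0"
  shows "real (card {n \<in> {1..L}. d dvd n}) \<le> real L / real d"
proof -
  have "{n \<in> {1..L}. d dvd n} \<subseteq> (*) d ` {1..L div d}"
  proof
    fix n assume "n \<in> {n \<in> {1..L}. d dvd n}"
    then obtain m where "n = d * m" "1 \<le> d * m" "d * m \<le> L" by auto
    then have "m \<in> {1..L div d}"
      using assms by (auto simp: less_eq_div_iff_mult_less_eq mult.commute Suc_le_eq)
    then show "n \<in> (*) d ` {1..L div d}" using \<open>n = d * m\<close> by auto
  qed
  then have "card {n \<in> {1..L}. d dvd n} \<le> card ((*) d ` {1..L div d})"
    by (intro card_mono) auto
  also have "\<dots> \<le> L div d" using card_image_le[of "{1..L div d}" "(*) d"] by simp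
  finally have "real (card {n \<in> {1..L}. d dvd n}) \<le> real (L div d)" by simp
  also have "\<dots> \<le> real L / real d" by (rule of_nat_div_le_of_nat)
  finally show ?thesis .
qed

text \<open>Expand the product over the sets \<open>T\<close> of primes of \<open>S\<close> dividing
  \<open>n\<close>. Each \<open>T\<close> is met once for every multiple of \<open>\<Prod>T\<close>
  up to \<open>L\<close>, at most \<open>L / \<Prod>T\<close> times, and the resulting sum over
  subsets folds back into a product.\<close>

lemma sum_prod_over_divisors_le:
  fixes g :: "nat \<Rightarrow> real"
  assumes "finite S" "\<And>p. p \<in> S \<Longrightarrow> prime p" "\<And>p. p \<in> S \<Longrightarrow> g p \<ge> 0"
  shows "(\<Sum>n=1..L. \<Prod>p | p \<in> S \<and> p dvd n. 1 + g p) \<le> real L * (\<Prod>p\<in>S. 1 + g p / real p)"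
proof -
  have "(\<Sum>n=1..L. \<Prod>p | p \<in> S \<and> p dvd n. 1 + g p)
      = (\<Sum>n=1..L. \<Sum>T\<in>Pow {p \<in> S. p dvd n}. \<Prod>p\<in>T. g p)"
    using assms by (subst add.commute, subst prod_add) auto
  \<comment> \<open>The test \<open>\<Prod>T dvd n\<close> makes the index set independent of
    \<open>n\<close>, which permits the interchange of the two sums.\<close>
  also have "\<dots> \<le> (\<Sum>n=1..L. \<Sum>T\<in>Pow S. if \<Prod>T dvd n then \<Prod>p\<in>T. g p else 0)"
  proof (intro sum_mono)
    fix n
    have "(\<Sum>T\<in>Pow {p \<in> S. p dvd n}. \<Prod>p\<in>T. g p) = (\<Sum>T\<in>Pow {p \<in> S. p dvd n}. if \<Prod>T dvd n then \<Prod>p\<in>T. g p else 0)"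
      using assms by (intro sum.cong refl) (auto dest: finite_subset intro!: prod_primes_dvd)
    also have "\<dots> \<le> (\<Sum>T\<in>Pow S. if \<Prod>T dvd n then \<Prod>p\<in>T. g p else 0)"
      using assms by (intro sum_mono2) (auto intro!: prod_nonneg)
    finally show "(\<Sum>T\<in>Pow {p \<in> S. p dvd n}. \<Prod>p\<in>T. g p) \<le> \<dots>" .
  qed
  also have "\<dots> = (\<Sum>T\<in>Pow S. (\<Prod>p\<in>T. g p) * real (card {n \<in> {1..L}. \<Prod>T dvd n}))"
    by (subst sum.swap) (simp add: sum.If_cases Collect_conj_eq[symmetric] mult.commute Int_def)
  also have "\<dots> \<le> (\<Sum>T\<in>Pow S. (\<Prod>p\<in>T. g p) * (real L / real (\<Prod>T)))"
  proof (intro sum_mono mult_left_mono card_multiples_le)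
    fix T assume "T \<in> Pow S"
    then show "0 < \<Prod>T" "0 \<le> (\<Prod>p\<in>T. g p)"
      using assms(2,3) by (auto intro!: prod_pos prod_nonneg) (metis prime_gt_0_nat subsetD)
  qed
  also have "\<dots> = real L * (\<Sum>T\<in>Pow S. \<Prod>p\<in>T. g p / real p)"
    by (simp add: sum_distrib_left prod_dividef mult_ac)
  also have "(\<Sum>T\<in>Pow S. \<Prod>p\<in>T. g p / real p) = (\<Prod>p\<in>S. 1 + g p / real p)"
    using assms by (subst add.commute, subst prod_add) auto
  finally show ?thesis .
qed

section \<open>Sums over lattice boxes, one coordinate at a time\<close>

lemma sum_PiE_Suc:
  fixes f :: "(nat \<Rightarrow> 'a) \<Rightarrow> real"
  assumes "1 \<le> n"
  shows "(\<Sum>h\<in>PiE {1..<Suc n} I. f h) = (\<Sum>h\<in>PiE {1..<n} I. \<Sum>x\<in>I n. f (h(n := x)))"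
proof -
  have n: "{1..<Suc n} = insert n {1..<n}" using assms by auto
  have "inj_on (\<lambda>(y, g). g(n := y)) (I n \<times> PiE {1..<n} I)"
    using inj_combinator[of n "{1..<n}" I] by simp
  then have "(\<Sum>h\<in>PiE {1..<Suc n} I. f h) = (\<Sum>(x, h)\<in>I n \<times> PiE {1..<n} I. f (h(n := x)))"
    unfolding n PiE_insert_eq by (subst sum.reindex) (auto simp: case_prod_unfold)
  also have "\<dots> = (\<Sum>h\<in>PiE {1..<n} I. \<Sum>x\<in>I n. f (h(n := x)))"
    by (subst sum.swap) (simp add: sum.cartesian_product)
  finally show ?thesis .
qed

text \<open>The last coordinate is summed first: by \<open>dep\<close> only one factor involves it,
  so the inner sum is at most \<open>W\<close> uniformly in the earlier coordinates, and the
  induction treats the rest.\<close>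

lemma sum_PiE_prod_le_power:
  fixes G :: "nat \<Rightarrow> (nat \<Rightarrow> 'a) \<Rightarrow> real"
  assumes "1 \<le> n" "W \<ge> 0"
    and nonneg: "\<And>i h. G i h \<ge> 0"
    and dep: "\<And>i h h'. (\<And>j. 1 \<le> j \<Longrightarrow> j \<le> i \<Longrightarrow> h j = h' j) \<Longrightarrow> G i h = G i h'"
    and bound: "\<And>i h. 1 \<le> i \<Longrightarrow> i < n \<Longrightarrow> h \<in> PiE {1..<i} I \<Longrightarrow> (\<Sum>x\<in>I i. G i (h(i := x))) \<le> W"
  shows "(\<Sum>h\<in>PiE {1..<n} I. \<Prod>i\<in>{1..<n}. G i h) \<le> W ^ (n - 1)"
  using assms(1) bound
proof (induction n rule: dec_induct)
  case (step n)
  have "(\<Sum>h\<in>PiE {1..<Suc n} I. \<Prod>i\<in>{1..<Suc n}. G i h)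
      = (\<Sum>h\<in>PiE {1..<n} I. (\<Prod>i\<in>{1..<n}. G i h) * (\<Sum>x\<in>I n. G n (h(n := x))))"
  proof -
    have "(\<Prod>i\<in>{1..<Suc n}. G i (h(n := x))) = (\<Prod>i\<in>{1..<n}. G i h) * G n (h(n := x))" for h x
    proof -
      have "(\<Prod>i\<in>{1..<n}. G i (h(n := x))) = (\<Prod>i\<in>{1..<n}. G i h)"
        by (intro prod.cong refl dep) auto
      then show ?thesis using \<open>1 \<le> n\<close> by (simp only: prod.op_ivl_Suc) simp
    qed
    then show ?thesis
      using \<open>1 \<le> n\<close> by (simp only: sum_PiE_Suc sum_distrib_left)
  qed
  also have "\<dots> \<le> (\<Sum>h\<in>PiE {1..<n} I. (\<Prod>i\<in>{1..<n}. G i h) * W)"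
    using \<open>1 \<le> n\<close> by (intro sum_mono mult_left_mono prod_nonneg step.prems nonneg) auto
  also have "\<dots> \<le> W ^ (n - 1) * W"
    using step \<open>W \<ge> 0\<close> by (auto simp flip: sum_distrib_right intro!: mult_right_mono)
  also have "\<dots> = W ^ (Suc n - 1)" using \<open>1 \<le> n\<close> by (cases n) auto
  finally show ?case .
qed simp

section \<open>Counting with the Chinese remainder theorem\<close>

lemma card_chinese_remainder:
  fixes A B :: "int set" and m n :: int
  assumes "coprime m n" "m > 0" "n > 0"
  shows "card {t \<in> {0..<m * n}. t mod m \<in> A \<and> t mod n \<in> B}
       = card {t \<in> {0..<m}. t \<in> A} * card {t \<in> {0..<n}. t \<in> B}"
proof -
  let ?f = "\<lambda>t. (t mod m, t mod n)"
  have "bij_betw ?f {t \<in> {0..<m * n}. t mod m \<in> A \<and> t mod n \<in> B}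
          ({t \<in> {0..<m}. t \<in> A} \<times> {t \<in> {0..<n}. t \<in> B})"
    unfolding bij_betw_def
  proof (intro conjI inj_onI equalityI subsetI)
    fix x y assume xy: "x \<in> {t \<in> {0..<m * n}. t mod m \<in> A \<and> t mod n \<in> B}"
      "y \<in> {t \<in> {0..<m * n}. t mod m \<in> A \<and> t mod n \<in> B}" "?f x = ?f y"
    then have "[x = y] (mod m * n)"
      using assms by (intro coprime_cong_mult) (auto simp: cong_def)
    with xy show "x = y" by (auto simp: cong_def)
  next
    fix z assume "z \<in> {t \<in> {0..<m}. t \<in> A} \<times> {t \<in> {0..<n}. t \<in> B}"
    then obtain a b where z: "z = (a, b)" "a \<in> {0..<m}" "a \<in> A" "b \<in> {0..<n}" "b \<in> B" by auto
    obtain x where x: "[x = a] (mod m)" "[x = b] (mod n)"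
      using binary_chinese_remainder_int[OF assms(1)] by blast
    have "?f (x mod (m * n)) = z"
      using x z by (auto simp: cong_def mod_mult2_eq' mod_mod_cancel)
    moreover have "x mod (m * n) \<in> {0..<m * n}" using assms by auto
    ultimately show "z \<in> ?f ` {t \<in> {0..<m * n}. t mod m \<in> A \<and> t mod n \<in> B}"
      using z by (intro image_eqI[of _ _ "x mod (m * n)"]) auto
  qed (use assms in auto)
  then show ?thesis by (simp add: bij_betw_same_card card_cartesian_product)
qed

text \<open>The primes treated so far act as the single modulus \<open>\<Prod>S\<close>, coprime to
  the new prime, so every induction step is an instance for two moduli.\<close>

lemma card_chinese_remainder_primes:
  fixes S :: "nat set" and A :: "nat \<Rightarrow> int set"
  assumes "finite S" "\<And>p. p \<in> S \<Longrightarrow> prime p"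
  shows "card {t \<in> {0..<int (\<Prod>S)}. \<forall>p\<in>S. t mod int p \<in> A p}
       = (\<Prod>p\<in>S. card {t \<in> {0..<int p}. t \<in> A p})"
  using assms
proof (induction S rule: finite_induct)
  case (insert p S)
  let ?n = "int (\<Prod>S)"
  define B where "B = {t. \<forall>p\<in>S. t mod int p \<in> A p}"
  have cop: "coprime (int p) ?n"
    using insert by (auto simp only: coprime_int_iff intro!: prod_coprime_right primes_coprime)
  have pos: "int p > 0" "?n > 0"
    using insert by (auto intro!: prod_pos simp: prime_gt_0_nat simp del: of_nat_prod)
  \<comment> \<open>Each prime of \<open>S\<close> divides \<open>\<Prod>S\<close>, so its condition
    can be read off from \<open>t mod \<Prod>S\<close>.\<close>
  have "{t \<in> {0..<int (\<Prod>(insert p S))}. \<forall>q\<in>insert p S. t mod int q \<in> A q}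
      = {t \<in> {0..<int p * ?n}. t mod int p \<in> A p \<and> t mod ?n \<in> B}"
    using insert by (auto simp: B_def mod_mod_cancel dvd_prodI)
  then have "card {t \<in> {0..<int (\<Prod>(insert p S))}. \<forall>q\<in>insert p S. t mod int q \<in> A q}
      = card {t \<in> {0..<int p}. t \<in> A p} * card {t \<in> {0..<?n}. t \<in> B}"
    using card_chinese_remainder[OF cop pos] by simp
  then show ?case using insert by (simp add: B_def)
next
  case empty
  have "{0..<1 :: int} = {0}" by auto
  then show ?case by simp
qed

section \<open>Residue sets and their correlations\<close>

lemma shift_count_cong:
  assumes "\<And>i. i \<in> {1..<k} \<Longrightarrow> h i mod int q = h' i mod int q"
  shows "shift_count k h q A = shift_count k h' q A"
proof -
  have "(t + (h(0 := 0)) i) mod int q = (t + (h'(0 := 0)) i) mod int q" if "i < k" for t i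
    using assms[of i] that by (cases "i = 0") (auto intro: mod_add_cong)
  then show ?thesis unfolding shift_count_def by (intro arg_cong[of _ _ card]) auto
qed

text \<open>The index \<open>0\<close> exists because of \<open>1 \<le> k\<close>, and as its shift
  is zero, its condition reads \<open>t \<in> A\<close>.\<close>

lemma shift_count_le_card:
  assumes "1 \<le> k" "finite A"
  shows "shift_count k h q A \<le> card A"
  unfolding shift_count_def
proof (intro card_mono assms subsetI)
  fix t assume t: "t \<in> {t \<in> {0..<int q}. \<forall>i<k. (t + (h(0 := 0)) i) mod int q \<in> A}"
  then have "\<forall>i<k. (t + (h(0 := 0)) i) mod int q \<in> A" by simp
  then have "0 < k \<longrightarrow> (t + (h(0 := 0)) 0) mod int q \<in> A" by (rule spec)
  with t show "t \<in> A" using assms(1) by simp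
qed

text \<open>The conditions on \<open>t\<close> depend only on the set of residues of the points.
  Dropping the \<open>c\<close> indices that repeat an earlier residue therefore loses nothing;
  index \<open>0\<close> always survives, and the survivors are renumbered.\<close>

lemma shift_count_distinct_residues:
  fixes h :: "nat \<Rightarrow> int" and p k :: nat
  defines "c \<equiv> card {i \<in> {1..<k}. \<exists>j<i. int p dvd (h(0 := 0)) i - (h(0 := 0)) j}"
  assumes "1 \<le> k"
  shows "\<exists>h' :: nat \<Rightarrow> int. c < k \<and> inj_on (\<lambda>i. (h'(0 := 0)) i mod int p) {..<k - c} \<and>
           (\<forall>A. shift_count k h p A = shift_count (k - c) h' p A)"
proof -
  define g where "g = h(0 := 0)"
  define D where "D = {i \<in> {1..<k}. \<exists>j<i. int p dvd g i - g j}"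
  define R where "R = {..<k} - D"
  have D: "D \<subseteq> {1..<k}" "card D = c" by (auto simp: D_def c_def g_def)
  have "finite D" using D finite_subset by blast
  have "card R = k - c" using D by (simp add: R_def card_Diff_subset \<open>finite D\<close> subset_iff)
  have "0 \<in> R" using D assms by (auto simp: R_def)
  have "c < k"
    using D assms card_mono[of "{1..<k}" D] by auto
  have "card {1..<k - c} = card (R - {0})"
    using \<open>card R = k - c\<close> \<open>0 \<in> R\<close> by simp
  then obtain f where f: "bij_betw f {1..<k - c} (R - {0})"
    using finite_same_card_bij[of "{1..<k - c}" "R - {0}"] by (auto simp: R_def)
  \<comment> \<open>Fixing \<open>0\<close> keeps the origin as the first point, so that
    \<open>g \<circ> e\<close> respects the convention for index \<open>0\<close>.\<close>
  define e where "e = f(0 := 0)"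
  have e: "bij_betw e {..<k - c} R"
  proof -
    have e1: "bij_betw e {1..<k - c} (R - {0})"
      using f by (rule iffD1[OF bij_betw_cong, rotated]) (auto simp: e_def)
    have "bij_betw e {0} {0}" by (auto simp: e_def bij_betw_def)
    then have "bij_betw e ({0} \<union> {1..<k - c}) ({0} \<union> (R - {0}))"
      using e1 by (rule bij_betw_combine) auto
    moreover have "{0} \<union> {1..<k - c} = {..<k - c}" using \<open>c < k\<close> by auto
    ultimately show ?thesis using \<open>0 \<in> R\<close> by (simp add: insert_absorb)
  qed
  have ge: "((g \<circ> e)(0 := 0)) = g \<circ> e" by (auto simp: e_def g_def)
  have inj: "inj_on (\<lambda>i. g i mod int p) R"
  proof (rule linorder_inj_onI)
    fix x y assume "x < y" "x \<in> R" "y \<in> R"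
    then have "\<not> int p dvd g y - g x" by (auto simp: R_def D_def)
    then show "g x mod int p \<noteq> g y mod int p" by (metis mod_eq_dvd_iff)
  qed auto
  \<comment> \<open>Following repetitions downwards ends at an index of \<open>R\<close> with the
    same residue.\<close>
  have rep: "\<exists>j\<in>R. g j mod int p = g i mod int p" if "i < k" for i
    using that
  proof (induction i rule: less_induct)
    case (less i)
    show ?case
    proof (cases "i \<in> R")
      case False
      then obtain j where "j < i" "int p dvd g i - g j"
        using less.prems by (auto simp: R_def D_def)
      then have "g j mod int p = g i mod int p" by (metis mod_eq_dvd_iff)
      with less.IH[OF \<open>j < i\<close>] less.prems \<open>j < i\<close> show ?thesis by auto
    qed auto
  qed
  have "shift_count k h p A = shift_count (k - c) (g \<circ> e) p A" for A
  proof -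
    have "(\<forall>i<k. (t + g i) mod int p \<in> A) \<longleftrightarrow> (\<forall>i<k - c. (t + (g \<circ> e) i) mod int p \<in> A)" for t
    proof
      assume "\<forall>i<k. (t + g i) mod int p \<in> A"
      moreover have "e i < k" if "i < k - c" for i
        using that e by (auto simp: bij_betw_def R_def)
      ultimately show "\<forall>i<k - c. (t + (g \<circ> e) i) mod int p \<in> A" by simp
    next
      assume *: "\<forall>i<k - c. (t + (g \<circ> e) i) mod int p \<in> A"
      show "\<forall>i<k. (t + g i) mod int p \<in> A"
      proof (intro allI impI)
        fix i assume "i < k"
        then obtain j where "j \<in> R" "g j mod int p = g i mod int p" using rep by blast
        moreover obtain l where "l < k - c" "e l = j"
          using e \<open>j \<in> R\<close> by (auto simp: bij_betw_def)
        ultimately show "(t + g i) mod int p \<in> A"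
          using * by (metis comp_apply mod_add_right_eq)
      qed
    qed
    then show ?thesis by (simp add: shift_count_def ge flip: g_def)
  qed
  moreover have "inj_on (\<lambda>i. ((g \<circ> e)(0 := 0)) i mod int p) {..<k - c}"
    unfolding ge using comp_inj_on[of e "{..<k - c}" "\<lambda>i. g i mod int p"] inj e
    by (simp add: bij_betw_def comp_def)
  ultimately show ?thesis using \<open>c < k\<close> by blast
qed

text \<open>An affine map whose slope is coprime to \<open>p\<close> permutes the residues modulo
  \<open>p\<close>.\<close>

lemma card_affine_preimage:
  fixes p m c :: int
  assumes "coprime m p" "p > 0" "A \<subseteq> {0..<p}"
  shows "card {w \<in> {0..<p}. (c + m * w) mod p \<in> A} = card A"
proof -
  let ?f = "\<lambda>w. (c + m * w) mod p"
  have inj: "inj_on ?f {0..<p}"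
  proof (rule inj_onI)
    fix x y assume xy: "x \<in> {0..<p}" "y \<in> {0..<p}" "?f x = ?f y"
    then have "[m * x = m * y] (mod p)" by (simp add: cong_def[symmetric] cong_add_lcancel)
    then have "[x = y] (mod p)" using assms(1) by (simp add: cong_mult_lcancel)
    with xy show "x = y" by (auto simp: cong_def)
  qed
  have "?f ` {0..<p} \<subseteq> {0..<p}" using assms by auto
  then have "?f ` {0..<p} = {0..<p}"
    using inj by (intro endo_inj_surj) auto
  then have "A \<subseteq> ?f ` {0..<p}" using assms(3) by simp
  then have img: "?f ` {w \<in> {0..<p}. ?f w \<in> A} = A" by (auto 4 3 simp: subset_iff image_iff)
  have "inj_on ?f {w \<in> {0..<p}. ?f w \<in> A}" using inj by (rule inj_on_subset) auto
  from card_image[OF this] show ?thesis unfolding img ..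
qed

text \<open>For fixed \<open>t \<in> A\<close> the coordinates of \<open>w\<close> are independent,
  and each affine condition has \<open>card A\<close> solutions. The multiplier \<open>m\<close>
  prepares translations that leave the residues modulo other primes alone.\<close>

lemma sum_shift_count_affine:
  fixes p k :: nat and m :: int
  assumes "coprime m (int p)" "p > 0" "A \<subseteq> {0..<int p}" "1 \<le> k"
  shows "(\<Sum>w\<in>PiE {1..<k} (\<lambda>_. {0..<int p}). shift_count k (\<lambda>i. h i + m * w i) p A) = card A ^ k"
proof -
  let ?W = "PiE {1..<k} (\<lambda>_. {0..<int p})"
  have finA: "finite A" using assms(3) finite_subset by blast
  have finW: "finite ?W" by (intro finite_PiE) auto
  have split: "(\<forall>i<k. (t + ((\<lambda>i. h i + m * w i)(0 := 0)) i) mod int p \<in> A)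
      \<longleftrightarrow> t \<in> A \<and> (\<forall>i\<in>{1..<k}. ((t + h i) + m * w i) mod int p \<in> A)" if "t \<in> {0..<int p}" for t w
  proof -
    have "{..<k} = insert 0 {1..<k}" using assms(4) by auto
    then have "(\<forall>i<k. P i) \<longleftrightarrow> P 0 \<and> (\<forall>i\<in>{1..<k}. P i)" for P
      by (metis insert_iff lessThan_iff)
    then show ?thesis using that by (auto simp: add.assoc)
  qed
  have "(\<Sum>w\<in>?W. shift_count k (\<lambda>i. h i + m * w i) p A)
      = (\<Sum>w\<in>?W. \<Sum>t\<in>A. if \<forall>i\<in>{1..<k}. ((t + h i) + m * w i) mod int p \<in> A then 1 else 0)"
  proof (intro sum.cong refl)
    fix w
    have "{t \<in> {0..<int p}. \<forall>i<k. (t + ((\<lambda>i. h i + m * w i)(0 := 0)) i) mod int p \<in> A}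
        = {t \<in> A. \<forall>i\<in>{1..<k}. ((t + h i) + m * w i) mod int p \<in> A}"
      using split assms(3) by blast
    then show "shift_count k (\<lambda>i. h i + m * w i) p A
        = (\<Sum>t\<in>A. if \<forall>i\<in>{1..<k}. ((t + h i) + m * w i) mod int p \<in> A then 1 else 0)"
      using finA by (simp add: shift_count_def sum.If_cases Int_def)
  qed
  also have "\<dots> = (\<Sum>t\<in>A. card {w \<in> ?W. \<forall>i\<in>{1..<k}. ((t + h i) + m * w i) mod int p \<in> A})"
    using finW by (subst sum.swap) (simp add: sum.If_cases Int_def)
  \<comment> \<open>The admissible \<open>w\<close> form a product set, one factor per
    coordinate.\<close>
  also have "\<dots> = (\<Sum>t\<in>A. card (PiE {1..<k} (\<lambda>i. {w \<in> {0..<int p}. ((t + h i) + m * w) mod int p \<in> A})))"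
    by (intro sum.cong arg_cong[of _ _ card] refl) (auto simp: PiE_iff extensional_def)
  also have "\<dots> = (\<Sum>t\<in>A. card A ^ (k - 1))"
    using card_affine_preimage[OF assms(1) _ assms(3)] assms(2) by (simp only: card_PiE finite_atLeastLessThan) simp
  also have "\<dots> = card A ^ k" using assms(4) by (cases k) auto
  finally show ?thesis .
qed

lemma prod_prime_factors_squarefree:
  fixes q :: nat
  assumes "squarefree q"
  shows "\<Prod>(prime_factors q) = q"
proof -
  have "q \<noteq> 0" using assms by (metis not_squarefree_0)
  then have "q = (\<Prod>p\<in>prime_factors q. p ^ multiplicity p q)"
    using prod_prime_factors[of q] by simp
  also have "\<dots> = \<Prod>(prime_factors q)"
    using assms \<open>q \<noteq> 0\<close> squarefree_factorial_semiring'[of q] by (intro prod.cong refl) auto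
  finally show ?thesis ..
qed

section \<open>Local deviations from the expected count\<close>

text \<open>The quantity \<open>e\<^sub>p(h)\<close>, defined for every \<open>h\<close>. Where
  points coincide modulo \<open>p\<close> it need not be small: if all of them coincide it equals
  \<open>\<sigma> p ^ (k - 1) - 1\<close>.\<close>

definition excess :: "(nat \<Rightarrow> int set) \<Rightarrow> nat \<Rightarrow> (nat \<Rightarrow> int) \<Rightarrow> nat \<Rightarrow> real" where
  "excess \<Omega> k h p = real (shift_count k h p (\<Omega> p)) * spacing p (\<Omega> p) ^ k / real p - 1"

lemma excess_cong:
  assumes "\<And>i. i \<in> {1..<k} \<Longrightarrow> h i mod int p = h' i mod int p"
  shows "excess \<Omega> k h p = excess \<Omega> k h' p"
  using shift_count_cong[OF assms] by (simp add: excess_def)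

locale residue_sets =
  fixes \<Omega> :: "nat \<Rightarrow> int set"
  assumes nonempty_subset: "\<And>p. prime p \<Longrightarrow> \<Omega> p \<noteq> {} \<and> \<Omega> p \<subseteq> {0..<int p}"
begin

abbreviation \<sigma> :: "nat \<Rightarrow> real" where
  "\<sigma> p \<equiv> spacing p (\<Omega> p)"

lemma finite_residues: "prime p \<Longrightarrow> finite (\<Omega> p)"
  using nonempty_subset finite_subset by blast

lemma card_residues: "prime p \<Longrightarrow> 0 < card (\<Omega> p) \<and> card (\<Omega> p) \<le> p"
  using nonempty_subset[of p] card_mono[of "{0..<int p}" "\<Omega> p"] finite_residues[of p]
  by (auto simp: card_gt_0_iff)

lemma spacing_bounds:
  assumes "prime p"
  shows "1 \<le> \<sigma> p" "\<sigma> p \<le> real p"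
  using card_residues[OF assms] by (auto simp: spacing_def field_simps)

lemma card_eq_div_spacing: "prime p \<Longrightarrow> real (card (\<Omega> p)) = real p / \<sigma> p"
  using card_residues[of p] prime_gt_0_nat[of p] by (simp add: spacing_def)

text \<open>The count is at most \<open>card (\<Omega> p) = p / \<sigma> p\<close>, whatever
  coincidences occur.\<close>

lemma one_plus_excess_bounds:
  assumes "prime p" "1 \<le> k"
  shows "0 \<le> 1 + excess \<Omega> k h p" "1 + excess \<Omega> k h p \<le> \<sigma> p ^ (k - 1)"
proof -
  have "real (shift_count k h p (\<Omega> p)) \<le> real p / \<sigma> p"
    using shift_count_le_card[OF assms(2) finite_residues[OF assms(1)], of h p]
    by (simp add: card_eq_div_spacing[OF assms(1), symmetric])
  then have "real (shift_count k h p (\<Omega> p)) * \<sigma> p ^ k / real p \<le> (real p / \<sigma> p) * \<sigma> p ^ k / real p"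
    using spacing_bounds[OF assms(1)] by (intro divide_right_mono mult_right_mono) auto
  also have "\<dots> = \<sigma> p ^ (k - 1)"
    using spacing_bounds[OF assms(1)] prime_gt_0_nat[OF assms(1)] assms(2)
    by (cases k) auto
  finally show "1 + excess \<Omega> k h p \<le> \<sigma> p ^ (k - 1)" by (simp add: excess_def)
  show "0 \<le> 1 + excess \<Omega> k h p"
    using spacing_bounds[OF assms(1)] by (simp add: excess_def)
qed

text \<open>A crude bound for use with divisors of small size, where a power of the divisor is
  affordable.\<close>

lemma abs_excess_le:
  assumes "prime p" "1 \<le> k"
  shows "\<bar>excess \<Omega> k h p\<bar> \<le> real p ^ (k - 1)"
proof -
  have "1 \<le> \<sigma> p ^ (k - 1)" "\<sigma> p ^ (k - 1) \<le> real p ^ (k - 1)"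
    using spacing_bounds[OF assms(1)] by (auto intro: power_mono)
  then show ?thesis using one_plus_excess_bounds[OF assms, of h] by linarith
qed

text \<open>Over a full system of residues the counts average to
  \<open>card (\<Omega> p) ^ k / p ^ (k - 1)\<close>, exactly the expected value, so the deviations
  have mean zero.\<close>

lemma sum_excess_affine:
  assumes "prime p" "coprime m (int p)" "1 \<le> k"
  shows "(\<Sum>w\<in>PiE {1..<k} (\<lambda>_. {0..<int p}). excess \<Omega> k (\<lambda>i. h i + m * w i) p) = 0"
proof -
  let ?W = "PiE {1..<k} (\<lambda>_. {0..<int p})"
  have p: "p > 0" using assms prime_gt_0_nat by blast
  have "card ?W = p ^ (k - 1)" by (simp add: card_PiE)
  then have "(\<Sum>w\<in>?W. excess \<Omega> k (\<lambda>i. h i + m * w i) p)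
      = real (\<Sum>w\<in>?W. shift_count k (\<lambda>i. h i + m * w i) p (\<Omega> p)) * \<sigma> p ^ k / real p - real p ^ (k - 1)"
    by (simp add: excess_def sum_subtractf sum_distrib_right sum_divide_distrib)
  also have "\<dots> = (real (card (\<Omega> p)) * \<sigma> p) ^ k / real p - real p ^ (k - 1)"
    using sum_shift_count_affine[OF assms(2) p _ assms(3)] nonempty_subset[OF assms(1)]
    by (simp add: power_mult_distrib)
  also have "\<dots> = 0"
    using p card_residues[OF assms(1)] assms(3) by (cases k) (auto simp: spacing_def)
  finally show ?thesis .
qed

section \<open>Factorization over the primes dividing a squarefree modulus\<close>

text \<open>Membership of all \<open>t + h i\<close> in \<open>crt_set \<Omega> q\<close> amounts to
  one condition on \<open>t mod p\<close> for each prime factor \<open>p\<close>, and these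
  conditions are independent.\<close>

lemma shift_count_crt_set:
  assumes "squarefree q"
  shows "shift_count k h q (crt_set \<Omega> q) = (\<Prod>p\<in>prime_factors q. shift_count k h p (\<Omega> p))"
proof -
  have q: "q > 0" using assms by (metis not_squarefree_0 gr0I)
  define A where "A p = {t. \<forall>i<k. (t + (h(0 := 0)) i) mod int p \<in> \<Omega> p}" for p
  have mod: "t mod int p \<in> A p \<longleftrightarrow> t \<in> A p" for t p
    by (simp add: A_def mod_add_left_eq)
  have "(\<forall>i<k. (t + (h(0 := 0)) i) mod int q \<in> crt_set \<Omega> q)
      \<longleftrightarrow> (\<forall>p\<in>prime_factors q. t mod int p \<in> A p)" for t
    unfolding mod using q by (auto simp: crt_set_def A_def in_prime_factors_iff mod_mod_cancel)
  then have "shift_count k h q (crt_set \<Omega> q)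
      = card {t \<in> {0..<int (\<Prod>(prime_factors q))}. \<forall>p\<in>prime_factors q. t mod int p \<in> A p}"
    by (simp add: shift_count_def prod_prime_factors_squarefree[OF assms] del: of_nat_prod)
  also have "\<dots> = (\<Prod>p\<in>prime_factors q. card {t \<in> {0..<int p}. t \<in> A p})"
    by (rule card_chinese_remainder_primes) auto
  finally show ?thesis by (simp add: A_def shift_count_def)
qed

text \<open>This is the case of a single point, where the shift count is a cardinality.\<close>

lemma card_crt_set:
  assumes "squarefree q"
  shows "card (crt_set \<Omega> q) = (\<Prod>p\<in>prime_factors q. card (\<Omega> p))"
proof -
  have "shift_count 1 h n A = card {t \<in> {0..<int n}. t \<in> A}" for h n A
    by (auto simp: shift_count_def intro!: arg_cong[of _ _ card])
  moreover have "{t \<in> {0..<int q}. t \<in> crt_set \<Omega> q} = crt_set \<Omega> q" by (auto simp: crt_set_def)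
  moreover have "{t \<in> {0..<int p}. t \<in> \<Omega> p} = \<Omega> p" if "p \<in> prime_factors q" for p
    using nonempty_subset that by blast
  ultimately show ?thesis
    using shift_count_crt_set[OF assms, of 1 "\<lambda>_. 0"] by (simp cong: prod.cong)
qed

lemma spacing_crt_set:
  assumes "squarefree q"
  shows "spacing q (crt_set \<Omega> q) = (\<Prod>p\<in>prime_factors q. \<sigma> p)"
  using prod_prime_factors_squarefree[OF assms]
  by (simp add: spacing_def card_crt_set[OF assms] prod_dividef flip: of_nat_prod)

text \<open>The local main terms multiply to \<open>q / s ^ k\<close>, and the normalization
  \<open>1 / card\<close> is \<open>s / q\<close>; together they leave
  \<open>1 / s ^ (k - 1)\<close>.\<close>

lemma correlation_crt_set:
  assumes "squarefree q" "1 \<le> k"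
  defines "s \<equiv> \<Prod>p\<in>prime_factors q. \<sigma> p"
  shows "correlation k X q (crt_set \<Omega> q)
       = (\<Sum>h\<in>dilate_lattice_points k s X. \<Prod>p\<in>prime_factors q. 1 + excess \<Omega> k h p) / s ^ (k - 1)"
proof -
  let ?S = "prime_factors q"
  have S: "prime p" if "p \<in> ?S" for p using that by auto
  have \<sigma>: "\<sigma> p > 0" "p > 0" if "p \<in> ?S" for p
    using spacing_bounds[OF S[OF that]] prime_gt_0_nat[OF S[OF that]] by auto
  have s: "s > 0" unfolding s_def by (intro prod_pos) (use \<sigma> in auto)
  have q: "q > 0" using assms(1) by (metis not_squarefree_0 gr0I)
  have count: "real (shift_count k h q (crt_set \<Omega> q)) = (\<Prod>p\<in>?S. 1 + excess \<Omega> k h p) * real q / s ^ k" for h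
  proof -
    have "(\<Prod>p\<in>?S. 1 + excess \<Omega> k h p)
        = (\<Prod>p\<in>?S. real (shift_count k h p (\<Omega> p))) * s ^ k / (\<Prod>p\<in>?S. real p)"
      by (simp add: excess_def s_def prod.distrib prod_dividef prod_power_distrib)
    also have "(\<Prod>p\<in>?S. real p) = real q"
      using prod_prime_factors_squarefree[OF assms(1)] by (simp flip: of_nat_prod)
    finally show ?thesis using s q by (simp add: shift_count_crt_set[OF assms(1)])
  qed
  have "s = real q / real (card (crt_set \<Omega> q))"
    using spacing_crt_set[OF assms(1)] by (simp add: spacing_def s_def)
  then have "1 / real (card (crt_set \<Omega> q)) = s / real q"
    using s q by (cases "card (crt_set \<Omega> q) = 0") auto
  moreover have "s / real q * (x * real q / s ^ k) = x / s ^ (k - 1)" for x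
    using s q assms(2) by (cases k) auto
  ultimately show ?thesis
    by (simp add: correlation_def spacing_crt_set[OF assms(1)] count sum_distrib_left sum_divide_distrib
        flip: s_def)
qed

end

section \<open>Weighted sums of the local deviations\<close>

text \<open>Every factor is at most the largest one, whose power is a term of the sum. In the place
  of Hoelder's inequality, this separates the differences \<open>h i - h j\<close> belonging to the
  same \<open>i\<close>.\<close>

lemma prod_le_sum_power:
  fixes a :: "'a \<Rightarrow> real"
  assumes "finite J" "J \<noteq> {}" "card J \<le> m" "\<And>j. j \<in> J \<Longrightarrow> 1 \<le> a j"
  shows "(\<Prod>j\<in>J. a j) \<le> (\<Sum>j\<in>J. a j ^ m)"
proof -
  obtain l where l: "l \<in> J" "\<And>j. j \<in> J \<Longrightarrow> a j \<le> a l"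
    using obtains_MAX[OF assms(1,2), of a] Max_ge[of "a ` J"] assms(1) by (metis finite_imageI imageI)
  have nonneg: "0 \<le> a j" if "j \<in> J" for j using assms(4)[OF that] by linarith
  have "(\<Prod>j\<in>J. a j) \<le> (\<Prod>j\<in>J. a l)" using l nonneg by (intro prod_mono) auto
  also have "\<dots> = a l ^ card J" by simp
  also have "\<dots> \<le> a l ^ m" using assms l by (intro power_increasing) auto
  also have "\<dots> \<le> (\<Sum>j\<in>J. a j ^ m)"
    using assms(1) l nonneg by (intro member_le_sum) auto
  finally show ?thesis .
qed

text \<open>A distance \<open>n \<ge> 1\<close> from \<open>c\<close> is attained by at most two
  integers, one on each side.\<close>

lemma sum_abs_diff_le:
  fixes f :: "nat \<Rightarrow> real" and c :: int
  assumes "\<And>n. 0 \<le> f n" "\<And>x. x \<in> I \<Longrightarrow> x \<noteq> c \<and> \<bar>x - c\<bar> \<le> int L"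
  shows "(\<Sum>x\<in>I. f (nat \<bar>x - c\<bar>)) \<le> 2 * (\<Sum>n=1..L. f n)"
proof -
  let ?A = "(\<lambda>n. c + int n) ` {1..L}" and ?B = "(\<lambda>n. c - int n) ` {1..L}"
  have sub: "I \<subseteq> ?A \<union> ?B"
  proof
    fix x assume "x \<in> I"
    then have x: "x \<noteq> c" "\<bar>x - c\<bar> \<le> int L" using assms(2) by auto
    show "x \<in> ?A \<union> ?B"
    proof (cases "x > c")
      case True
      then have "x \<in> ?A" using x by (intro image_eqI[of _ _ "nat (x - c)"]) auto
      then show ?thesis ..
    next
      case False
      then have "x \<in> ?B" using x by (intro image_eqI[of _ _ "nat (c - x)"]) auto
      then show ?thesis ..
    qed
  qed
  have "(\<Sum>x\<in>I. f (nat \<bar>x - c\<bar>)) \<le> (\<Sum>x\<in>?A \<union> ?B. f (nat \<bar>x - c\<bar>))"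
    using sub assms(1) by (intro sum_mono2) auto
  also have "\<dots> \<le> (\<Sum>x\<in>?A. f (nat \<bar>x - c\<bar>)) + (\<Sum>x\<in>?B. f (nat \<bar>x - c\<bar>))"
    using assms(1) by (subst sum_Un) (auto intro!: sum_nonneg)
  also have "(\<Sum>x\<in>?A. f (nat \<bar>x - c\<bar>)) = (\<Sum>n=1..L. f n)"
    by (subst sum.reindex) (auto intro!: inj_onI)
  also have "(\<Sum>x\<in>?B. f (nat \<bar>x - c\<bar>)) = (\<Sum>n=1..L. f n)"
    by (subst sum.reindex) (auto intro!: inj_onI)
  finally show ?thesis by simp
qed

text \<open>The growth condition has the shape in which the divisor sums use it. Equidistribution is
  assumed for all orders \<open>m \<le> k\<close>, because coincidences modulo \<open>p\<close>
  lower the order of the correlation.\<close>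

locale poisson_family = residue_sets \<Omega> for \<Omega> +
  fixes k :: nat and \<epsilon> A C :: real
  assumes k: "2 \<le> k" and eps: "0 < \<epsilon>" and C: "0 \<le> C"
    and spacing_growth: "\<And>p. prime p \<Longrightarrow> spacing p (\<Omega> p) ^ (k - 1) \<le> A * real p powr (1 - \<epsilon>)"
    and equidistributed: "\<And>m p h. 2 \<le> m \<Longrightarrow> m \<le> k \<Longrightarrow> prime p \<Longrightarrow>
           inj_on (\<lambda>i. (h(0 := 0)) i mod int p) {..<m} \<Longrightarrow>
           \<bar>excess \<Omega> m h p\<bar> \<le> C * (1 - 1 / spacing p (\<Omega> p)) * real p powr (- \<epsilon>)"
begin

text \<open>The exponent in Rankin's trick. It is small enough that \<open>k - 1\<close> weights
  \<open>p powr \<alpha>\<close> cost at most \<open>p powr (\<epsilon> / 2)\<close>, half of the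
  available saving.\<close>

definition \<alpha> :: real where "\<alpha> = \<epsilon> / (2 * real k)"

text \<open>The charge for one coincidence modulo \<open>p\<close>, including the Rankin
  weight.\<close>

definition u :: "nat \<Rightarrow> real" where "u p = 1 + real p powr \<alpha> * (\<sigma> p - 1)"

text \<open>The charge for the equidistribution error of the points that stay distinct modulo
  \<open>p\<close>, including the Rankin weight.\<close>

definition v :: "nat \<Rightarrow> real" where
  "v p = 1 + real p powr \<alpha> * (C * (1 - 1 / \<sigma> p) * real p powr (- \<epsilon>))"

lemma alpha: "0 < \<alpha>" "\<alpha> * real (k - 1) \<le> \<epsilon> / 2" "\<alpha> \<le> \<epsilon> / 2"
  using k eps by (auto simp: \<alpha>_def field_simps of_nat_diff)

lemma A_nonneg: "0 \<le> A"
proof -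
  have "(0::real) < 2 powr (1 - \<epsilon>)" by simp
  moreover have "1 \<le> \<sigma> 2 ^ (k - 1)" using spacing_bounds[OF two_is_prime_nat] by simp
  ultimately show ?thesis
    using spacing_growth[OF two_is_prime_nat] zero_less_mult_iff[of A "2 powr (1 - \<epsilon>)"] by simp
qed

lemma powr_alpha_ge_1: "prime p \<Longrightarrow> 1 \<le> real p powr \<alpha>"
  using alpha prime_ge_1_nat[of p] by (intro ge_one_powr_ge_zero) auto

lemma u_ge_1: "prime p \<Longrightarrow> 1 \<le> u p"
  using powr_alpha_ge_1[of p] spacing_bounds[of p] by (auto simp: u_def)

lemma v_ge_1: "prime p \<Longrightarrow> 1 \<le> v p"
  using C spacing_bounds[of p] by (auto simp: v_def intro!: mult_nonneg_nonneg)

lemma v_nonneg: "prime p \<Longrightarrow> 0 \<le> v p"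
  using v_ge_1[of p] by simp

text \<open>A single point is left when all points coincide modulo \<open>p\<close>; this order lies
  below the range of \<open>equidistributed\<close>, but its count is exact.\<close>

lemma excess_one:
  assumes "prime p"
  shows "excess \<Omega> 1 h p = 0"
proof -
  have "{t \<in> {0..<int p}. \<forall>i<1. (t + (h(0 := 0)) i) mod int p \<in> \<Omega> p} = \<Omega> p"
    using nonempty_subset[OF assms] by auto
  then have "shift_count 1 h p (\<Omega> p) = card (\<Omega> p)" by (simp only: shift_count_def)
  then show ?thesis
    using card_residues[OF assms] prime_gt_0_nat[OF assms] by (simp add: excess_def spacing_def)
qed

text \<open>Removing the \<open>c h\<close> coincidences turns \<open>1 + excess\<close> of order
  \<open>k\<close> into \<open>\<sigma> p ^ c h\<close> times \<open>1 + e\<close> of order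
  \<open>k - c h\<close>, where \<open>e\<close> is controlled by equidistribution. The weight is
  then distributed over both parts.\<close>

lemma weighted_excess_le:
  assumes "prime p"
  defines "c \<equiv> \<lambda>h. card {i \<in> {1..<k}. \<exists>j<i. int p dvd (h(0 := 0)) i - (h(0 := 0)) j}"
  shows "1 + real p powr \<alpha> * \<bar>excess \<Omega> k h p\<bar> \<le> v p * u p ^ c h"
proof -
  define P where "P = real p powr \<alpha>"
  define s where "s = \<sigma> p"
  define y where "y = C * (1 - 1 / \<sigma> p) * real p powr (- \<epsilon>)"
  have P: "1 \<le> P" using powr_alpha_ge_1[OF assms(1)] by (simp add: P_def)
  have s: "1 \<le> s" using spacing_bounds[OF assms(1)] by (simp add: s_def)
  have y: "0 \<le> y" using C s by (auto simp: y_def s_def[symmetric] intro!: mult_nonneg_nonneg)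
  have "1 \<le> k" using k by simp
  from shift_count_distinct_residues[OF this, where h = h and p = p] obtain h' where h': "c h < k"
    "inj_on (\<lambda>i. (h'(0 := 0)) i mod int p) {..<k - c h}"
    "\<And>B. shift_count k h p B = shift_count (k - c h) h' p B"
    unfolding c_def by blast
  define e where "e = excess \<Omega> (k - c h) h' p"
  have e: "\<bar>e\<bar> \<le> y"
  proof (cases "k - c h = 1")
    case True
    then show ?thesis using y excess_one[OF assms(1)] by (simp add: e_def)
  next
    case False
    then have "2 \<le> k - c h" using h'(1) by linarith
    then show ?thesis
      unfolding e_def y_def by (intro equidistributed assms(1) h'(2)) auto
  qed
  have "s ^ k = s ^ (k - c h) * s ^ c h"
    using h'(1) by (simp flip: power_add)
  then have "excess \<Omega> k h p = s ^ c h * (1 + e) - 1"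
    by (simp add: excess_def e_def h'(3) s_def)
  also have "\<bar>\<dots>\<bar> = \<bar>(s ^ c h - 1) + s ^ c h * e\<bar>" by (simp add: algebra_simps)
  also have "\<dots> \<le> \<bar>s ^ c h - 1\<bar> + \<bar>s ^ c h * e\<bar>" by (rule abs_triangle_ineq)
  also have "\<dots> \<le> (s ^ c h - 1) + s ^ c h * y"
    using s e by (auto simp: abs_mult intro!: mult_left_mono)
  finally have "1 + P * \<bar>excess \<Omega> k h p\<bar> \<le> 1 + P * ((s ^ c h - 1) + s ^ c h * y)"
    using P by (intro add_left_mono mult_left_mono) auto
  \<comment> \<open>The right side exceeds the left by
    \<open>P * (P - 1) * y * (s ^ c h - 1)\<close>.\<close>
  also have "\<dots> \<le> (1 + P * y) * (1 + P * (s ^ c h - 1))"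
  proof -
    have "1 * (P * y * (s ^ c h - 1)) \<le> P * (P * y * (s ^ c h - 1))"
      using P y s by (intro mult_right_mono) auto
    then show ?thesis by (simp add: algebra_simps)
  qed
  also have "\<dots> \<le> (1 + P * y) * (1 + P * (s - 1)) ^ c h"
    using P y s by (intro mult_left_mono power_dilate_le) auto
  finally show ?thesis by (simp add: P_def y_def s_def v_def u_def)
qed

text \<open>If point \<open>i\<close> repeats an earlier one modulo \<open>p\<close>, then
  \<open>p\<close> divides some \<open>h i - h j\<close> with \<open>j < i\<close>. In the proof
  \<open>F\<close> gathers the charges of the primes dividing one difference, and \<open>G i\<close>
  those of all differences of point \<open>i\<close> with earlier points. Summing the coordinates
  from the last to the first leaves a divisor sum of \<open>F ^ (k - 1)\<close>; by
  \<open>sep\<close> the absolute differences stay in \<open>{1..L}\<close>.\<close>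

lemma sum_weighted_excess_le:
  fixes I :: "nat \<Rightarrow> int set"
  assumes S: "finite S" "\<And>p. p \<in> S \<Longrightarrow> prime p"
    and sep: "\<And>i j x y. i < j \<Longrightarrow> j < k \<Longrightarrow> x \<in> (I(0 := {0})) i \<Longrightarrow> y \<in> I j \<Longrightarrow> x \<noteq> y \<and> \<bar>y - x\<bar> \<le> int L"
  shows "(\<Sum>h\<in>PiE {1..<k} I. \<Prod>p\<in>S. 1 + real p powr \<alpha> * \<bar>excess \<Omega> k h p\<bar>)
       \<le> (\<Prod>p\<in>S. v p) * (2 * real k * (real L * (\<Prod>p\<in>S. 1 + (u p ^ (k - 1) - 1) / real p))) ^ (k - 1)"
proof -
  define F where "F n = (\<Prod>p\<in>S. if p dvd n then u p else 1)" for n :: nat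
  define G where "G i h = (\<Prod>j<i. F (nat \<bar>(h(0 := 0)) i - (h(0 := 0)) j\<bar>))" for i and h :: "nat \<Rightarrow> int"
  define W where "W = 2 * real k * (real L * (\<Prod>p\<in>S. 1 + (u p ^ (k - 1) - 1) / real p))"
  have u1: "1 \<le> u p" if "p \<in> S" for p using u_ge_1 S(2)[OF that] by blast
  have F1: "1 \<le> F n" for n unfolding F_def using u1 by (intro prod_ge_1) auto
  have G0: "0 \<le> G i h" for i h
    unfolding G_def using F1 by (intro prod_nonneg) (auto intro: order_trans[OF zero_le_one])
  have "(\<Sum>n=1..L. F n ^ (k - 1)) = (\<Sum>n=1..L. \<Prod>p | p \<in> S \<and> p dvd n. 1 + (u p ^ (k - 1) - 1))"
  proof (intro sum.cong refl)
    fix n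
    have "F n ^ (k - 1) = (\<Prod>p\<in>S. if p dvd n then 1 + (u p ^ (k - 1) - 1) else 1)"
      unfolding F_def prod_power_distrib by (intro prod.cong refl) simp
    then show "F n ^ (k - 1) = (\<Prod>p | p \<in> S \<and> p dvd n. 1 + (u p ^ (k - 1) - 1))"
      by (simp only: prod.inter_filter[OF S(1)])
  qed
  also have "\<dots> \<le> real L * (\<Prod>p\<in>S. 1 + (u p ^ (k - 1) - 1) / real p)"
    using u1 by (intro sum_prod_over_divisors_le S) auto
  finally have W: "2 * real k * (\<Sum>n=1..L. F n ^ (k - 1)) \<le> W"
    unfolding W_def by (intro mult_left_mono) auto
  have F0: "0 \<le> F n ^ (k - 1)" for n using F1[of n] by simp
  have "0 \<le> (\<Sum>n=1..L. F n ^ (k - 1))" by (intro sum_nonneg F0)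
  then have W0: "0 \<le> W" using W by (smt (verit) mult_nonneg_nonneg of_nat_0_le_iff)
  have pointwise: "(\<Prod>p\<in>S. 1 + real p powr \<alpha> * \<bar>excess \<Omega> k h p\<bar>) \<le> (\<Prod>p\<in>S. v p) * (\<Prod>i\<in>{1..<k}. G i h)" for h
  proof -
    define g where "g = h(0 := 0)"
    have "(\<Prod>p\<in>S. 1 + real p powr \<alpha> * \<bar>excess \<Omega> k h p\<bar>)
        \<le> (\<Prod>p\<in>S. v p * u p ^ card {i \<in> {1..<k}. \<exists>j<i. int p dvd g i - g j})"
      unfolding g_def using S(2) by (intro prod_mono conjI weighted_excess_le) auto
    also have "\<dots> = (\<Prod>p\<in>S. v p) * (\<Prod>p\<in>S. \<Prod>i\<in>{1..<k}. if \<exists>j<i. int p dvd g i - g j then u p else 1)"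
      by (simp add: prod.distrib flip: prod.inter_filter)
    also have "(\<Prod>p\<in>S. \<Prod>i\<in>{1..<k}. if \<exists>j<i. int p dvd g i - g j then u p else 1)
        \<le> (\<Prod>p\<in>S. \<Prod>i\<in>{1..<k}. \<Prod>j<i. if p dvd nat \<bar>g i - g j\<bar> then u p else 1)"
    proof (intro prod_mono conjI prod_nonneg ballI)
      fix p i assume p: "p \<in> S" and "i \<in> {1..<k}"
      show "0 \<le> (if \<exists>j<i. int p dvd g i - g j then u p else 1)" using u1[OF p] by auto
      show "(if \<exists>j<i. int p dvd g i - g j then u p else 1) \<le> (\<Prod>j<i. if p dvd nat \<bar>g i - g j\<bar> then u p else 1)"
      proof (cases "\<exists>j<i. int p dvd g i - g j")
        case True
        then obtain j where j: "j < i" "int p dvd g i - g j" by blast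
        then have dvd: "p dvd nat \<bar>g i - g j\<bar>" by (simp add: nat_dvd_iff int_dvd_int_iff[symmetric])
        \<comment> \<open>One index \<open>j\<close> with a divisible difference supplies the factor
          \<open>u p\<close>; the other factors are at least \<open>1\<close>.\<close>
        have "u p * 1 \<le> (if p dvd nat \<bar>g i - g j\<bar> then u p else 1)
            * (\<Prod>j\<in>{..<i} - {j}. if p dvd nat \<bar>g i - g j\<bar> then u p else 1)"
          using dvd u1[OF p] by (intro mult_mono prod_ge_1) auto
        also have "\<dots> = (\<Prod>j<i. if p dvd nat \<bar>g i - g j\<bar> then u p else 1)"
          using j by (subst (2) prod.remove[of _ j]) auto
        finally show ?thesis using True by simp
      next
        case False
        then show ?thesis using u1[OF p] by (auto intro!: prod_ge_1)
      qed
    qed (use u1 in \<open>auto intro: order_trans[OF zero_le_one]\<close>)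
    also have "\<dots> = (\<Prod>i\<in>{1..<k}. G i h)"
      unfolding G_def F_def g_def by (subst prod.swap, subst (2) prod.swap) simp
    finally show ?thesis using v_nonneg S(2) by (simp add: mult_left_mono prod_nonneg)
  qed
  have "(\<Sum>h\<in>PiE {1..<k} I. \<Prod>p\<in>S. 1 + real p powr \<alpha> * \<bar>excess \<Omega> k h p\<bar>)
      \<le> (\<Prod>p\<in>S. v p) * (\<Sum>h\<in>PiE {1..<k} I. \<Prod>i\<in>{1..<k}. G i h)"
    unfolding sum_distrib_left by (intro sum_mono pointwise)
  also have "\<dots> \<le> (\<Prod>p\<in>S. v p) * W ^ (k - 1)"
  proof (intro mult_left_mono sum_PiE_prod_le_power)
    fix i h assume i: "1 \<le> i" "i < k" and h: "h \<in> PiE {1..<i} I"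
    define g where "g = h(0 := 0)"
    have g: "g j \<in> (I(0 := {0})) j" if "j < i" for j
      using h that by (auto simp: g_def PiE_iff)
    have "(\<Sum>x\<in>I i. G i (h(i := x))) = (\<Sum>x\<in>I i. \<Prod>j<i. F (nat \<bar>x - g j\<bar>))"
      unfolding G_def g_def using i by (intro sum.cong prod.cong refl) auto
    \<comment> \<open>There are \<open>i \<le> k - 1\<close> factors, so the exponent
      \<open>k - 1\<close> serves every \<open>i\<close>.\<close>
    also have "\<dots> \<le> (\<Sum>x\<in>I i. \<Sum>j<i. F (nat \<bar>x - g j\<bar>) ^ (k - 1))"
      using i F1 by (intro sum_mono prod_le_sum_power) (auto simp: lessThan_empty_iff bot_nat_def)
    also have "\<dots> = (\<Sum>j<i. \<Sum>x\<in>I i. F (nat \<bar>x - g j\<bar>) ^ (k - 1))" by (rule sum.swap)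
    also have "\<dots> \<le> (\<Sum>j<i. 2 * (\<Sum>n=1..L. F n ^ (k - 1)))"
    proof (intro sum_mono sum_abs_diff_le F0)
      fix j x assume "j \<in> {..<i}" "x \<in> I i"
      then show "x \<noteq> g j \<and> \<bar>x - g j\<bar> \<le> int L"
        using sep[of j i "g j" x] g i by auto
    qed
    also have "\<dots> \<le> 2 * real k * (\<Sum>n=1..L. F n ^ (k - 1))"
      using i F0 by (auto intro!: mult_right_mono sum_nonneg)
    also note W
    finally show "(\<Sum>x\<in>I i. G i (h(i := x))) \<le> W" .
  next
    fix i and h h' :: "nat \<Rightarrow> int" assume "\<And>j. 1 \<le> j \<Longrightarrow> j \<le> i \<Longrightarrow> h j = h' j"
    then show "G i h = G i h'"
      unfolding G_def by (intro prod.cong refl) auto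
  qed (use k W0 G0 v_nonneg S(2) in \<open>auto intro!: prod_nonneg\<close>)
  finally show ?thesis unfolding W_def .
qed

text \<open>By \<open>\<alpha> \<le> \<epsilon> / 2\<close>, half of the saving survives the Rankin
  weight, and \<open>1 - 1 / \<sigma> p \<le> ln (\<sigma> p)\<close> gives the slowly growing
  form.\<close>

lemma v_le:
  assumes "prime p"
  shows "v p \<le> 1 + C * real p powr (- (\<epsilon> / 2)) * ln (\<sigma> p)"
proof -
  have "real p powr \<alpha> * real p powr (- \<epsilon>) = real p powr (\<alpha> - \<epsilon>)"
    by (simp add: powr_diff powr_minus field_simps)
  also have "\<dots> \<le> real p powr (- (\<epsilon> / 2))"
    using alpha prime_ge_1_nat[OF assms] by (intro powr_mono) auto
  finally have "C * (real p powr \<alpha> * real p powr (- \<epsilon>)) * (1 - 1 / \<sigma> p)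
      \<le> C * real p powr (- (\<epsilon> / 2)) * ln (\<sigma> p)"
    using C spacing_bounds[OF assms] by (intro mult_mono one_minus_inverse_le_ln mult_left_mono) auto
  then show ?thesis by (simp add: v_def mult_ac)
qed

text \<open>The weights cost \<open>p powr (\<epsilon> / 2)\<close> and the spacings
  \<open>A * p powr (1 - \<epsilon>)\<close>, so the division by \<open>p\<close> leaves
  \<open>p powr (- (\<epsilon> / 2))\<close>.\<close>

lemma u_power_le:
  assumes "prime p"
  shows "1 + (u p ^ (k - 1) - 1) / real p \<le> 1 + real (k - 1) * A * real p powr (- (\<epsilon> / 2)) * ln (\<sigma> p)"
proof -
  have p: "1 \<le> real p" using prime_ge_1_nat[OF assms] by simp
  have ln: "0 \<le> ln (\<sigma> p)" using spacing_bounds[OF assms] by simp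
  have "(real p powr \<alpha> * \<sigma> p) ^ (k - 1) = real p powr (\<alpha> * real (k - 1)) * \<sigma> p ^ (k - 1)"
    using p by (simp add: power_mult_distrib powr_realpow[symmetric] powr_powr)
  also have "\<dots> \<le> real p powr (\<epsilon> / 2) * (A * real p powr (1 - \<epsilon>))"
    using p alpha spacing_growth[OF assms] spacing_bounds[OF assms]
    by (intro mult_mono powr_mono) auto
  also have "\<dots> = A * (real p powr (- (\<epsilon> / 2)) * real p)"
    using p by (simp add: powr_add[symmetric] powr_mult_base mult.commute[of _ "real p"] del: powr_minus)
  finally have "real (k - 1) * (real p powr \<alpha> * \<sigma> p) ^ (k - 1) * ln (\<sigma> p)
      \<le> real (k - 1) * (A * (real p powr (- (\<epsilon> / 2)) * real p)) * ln (\<sigma> p)"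
    using ln by (intro mult_right_mono mult_left_mono) auto
  moreover have "u p ^ (k - 1) - 1 \<le> real (k - 1) * (real p powr \<alpha> * \<sigma> p) ^ (k - 1) * ln (\<sigma> p)"
    unfolding u_def using powr_alpha_ge_1[OF assms] spacing_bounds[OF assms]
    by (intro power_dilate_minus_one_le)
  ultimately have "(u p ^ (k - 1) - 1) / real p
      \<le> real (k - 1) * (A * (real p powr (- (\<epsilon> / 2)) * real p)) * ln (\<sigma> p) / real p"
    using p by (intro divide_right_mono) auto
  then show ?thesis using p by (simp add: mult_ac)
qed

text \<open>Both products over \<open>S\<close> are of slowly growing form, hence bounded by a small
  power of the spacing. The constant precedes \<open>S\<close>, \<open>L\<close> and
  \<open>I\<close>, so the bound is uniform in the modulus and in the box.\<close>

lemma sum_weighted_excess_bound: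
  assumes "0 < \<eta>"
  shows "\<exists>M\<ge>0. \<forall>S L (I :: nat \<Rightarrow> int set). finite S \<longrightarrow> (\<forall>p\<in>S. prime p) \<longrightarrow>
           (\<forall>i j x y. i < j \<longrightarrow> j < k \<longrightarrow> x \<in> (I(0 := {0})) i \<longrightarrow> y \<in> I j \<longrightarrow> x \<noteq> y \<and> \<bar>y - x\<bar> \<le> int L) \<longrightarrow>
           (\<Sum>h\<in>PiE {1..<k} I. \<Prod>p\<in>S. 1 + real p powr \<alpha> * \<bar>excess \<Omega> k h p\<bar>)
             \<le> M * real L ^ (k - 1) * (\<Prod>p\<in>S. \<sigma> p) powr \<eta>"
proof -
  \<comment> \<open>The product of the \<open>v p\<close> enters once and that of the
    \<open>u p\<close> bound \<open>k - 1\<close> times, \<open>k\<close> factors in all.\<close>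
  define \<eta>' where "\<eta>' = \<eta> / real k"
  have \<eta>': "0 < \<eta>'" "\<eta>' * real k = \<eta>" using assms k by (auto simp: \<eta>'_def)
  have half: "0 < \<epsilon> / 2" using eps by simp
  have bounds: "1 \<le> \<sigma> p \<and> \<sigma> p \<le> real p" if "prime p" for p using spacing_bounds[OF that] by simp
  obtain M1 where M1: "0 \<le> M1" "\<And>S. finite S \<Longrightarrow> (\<forall>p\<in>S. prime p) \<Longrightarrow>
      (\<Prod>p\<in>S. 1 + C * real p powr (- (\<epsilon> / 2)) * ln (\<sigma> p)) \<le> M1 * (\<Prod>p\<in>S. \<sigma> p) powr \<eta>'"
    using prod_slowly_growing[of \<sigma>, OF bounds C half \<eta>'(1)] by blast
  have "0 \<le> real (k - 1) * A" using A_nonneg by simp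
  from prod_slowly_growing[of \<sigma>, OF bounds this half \<eta>'(1)]
  obtain M2 where M2: "0 \<le> M2" "\<And>S. finite S \<Longrightarrow> (\<forall>p\<in>S. prime p) \<Longrightarrow>
      (\<Prod>p\<in>S. 1 + real (k - 1) * A * real p powr (- (\<epsilon> / 2)) * ln (\<sigma> p)) \<le> M2 * (\<Prod>p\<in>S. \<sigma> p) powr \<eta>'"
    by blast
  define M where "M = M1 * (2 * real k * M2) ^ (k - 1)"
  show ?thesis
  proof (intro exI[of _ M] conjI allI impI)
    show "0 \<le> M" using M1(1) M2(1) by (simp add: M_def)
    fix S :: "nat set" and L :: nat and I :: "nat \<Rightarrow> int set"
    assume S: "finite S" "\<forall>p\<in>S. prime p"
      and sep: "\<forall>i j x y. i < j \<longrightarrow> j < k \<longrightarrow> x \<in> (I(0 := {0})) i \<longrightarrow> y \<in> I j \<longrightarrow> x \<noteq> y \<and> \<bar>y - x\<bar> \<le> int L"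
    define s where "s = (\<Prod>p\<in>S. \<sigma> p)"
    have "(\<Prod>p\<in>S. v p) \<le> (\<Prod>p\<in>S. 1 + C * real p powr (- (\<epsilon> / 2)) * ln (\<sigma> p))"
      using S v_le v_nonneg by (intro prod_mono) auto
    also have "\<dots> \<le> M1 * s powr \<eta>'" unfolding s_def by (rule M1(2)[OF S])
    finally have V: "(\<Prod>p\<in>S. v p) \<le> M1 * s powr \<eta>'" .
    have u0: "0 \<le> 1 + (u p ^ (k - 1) - 1) / real p" if "p \<in> S" for p
      using u_ge_1[of p] S that by (auto intro!: add_nonneg_nonneg divide_nonneg_nonneg)
    have "(\<Prod>p\<in>S. 1 + (u p ^ (k - 1) - 1) / real p)
        \<le> (\<Prod>p\<in>S. 1 + real (k - 1) * A * real p powr (- (\<epsilon> / 2)) * ln (\<sigma> p))"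
      using S u_power_le u0 by (intro prod_mono) auto
    also have "\<dots> \<le> M2 * s powr \<eta>'" unfolding s_def by (rule M2(2)[OF S])
    finally have U: "(\<Prod>p\<in>S. 1 + (u p ^ (k - 1) - 1) / real p) \<le> M2 * s powr \<eta>'" .
    have U0: "0 \<le> (\<Prod>p\<in>S. 1 + (u p ^ (k - 1) - 1) / real p)" using u0 by (intro prod_nonneg) auto
    have "(\<Sum>h\<in>PiE {1..<k} I. \<Prod>p\<in>S. 1 + real p powr \<alpha> * \<bar>excess \<Omega> k h p\<bar>)
        \<le> (\<Prod>p\<in>S. v p) * (2 * real k * (real L * (\<Prod>p\<in>S. 1 + (u p ^ (k - 1) - 1) / real p))) ^ (k - 1)"
      using S sep by (intro sum_weighted_excess_le) blast+
    also have "\<dots> \<le> (M1 * s powr \<eta>') * (2 * real k * (real L * (M2 * s powr \<eta>'))) ^ (k - 1)"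
      using U U0 V M1(1) by (intro mult_mono power_mono mult_left_mono) (auto intro!: mult_nonneg_nonneg)
    also have "\<dots> = M * real L ^ (k - 1) * (s powr \<eta>' * (s powr \<eta>') ^ (k - 1))"
      by (simp add: M_def power_mult_distrib mult_ac)
    also have "s powr \<eta>' * (s powr \<eta>') ^ (k - 1) = (s powr \<eta>') ^ k"
      using k by (cases k) auto
    also have "\<dots> = s powr \<eta>"
    proof -
      have "0 < s" unfolding s_def using S bounds by (intro prod_pos) (auto intro: less_le_trans[OF zero_less_one])
      then show ?thesis by (simp add: powr_realpow[symmetric] powr_powr \<eta>')
    qed
    finally show "(\<Sum>h\<in>PiE {1..<k} I. \<Prod>p\<in>S. 1 + real p powr \<alpha> * \<bar>excess \<Omega> k h p\<bar>)
        \<le> M * real L ^ (k - 1) * (\<Prod>p\<in>S. \<sigma> p) powr \<eta>" by (simp add: s_def)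
  qed
qed

end

section \<open>Moduli of small size\<close>

text \<open>A union bound for the boundary layers of a box: the layer in direction \<open>i\<close>
  has at most \<open>d\<close> values there and at most \<open>L\<close> in every other
  direction.\<close>

lemma card_slabs_le:
  fixes X Y :: "'i \<Rightarrow> 'a set"
  assumes "finite I" and X: "\<And>i. i \<in> I \<Longrightarrow> finite (X i) \<and> card (X i) \<le> d"
    and Y: "\<And>i. i \<in> I \<Longrightarrow> finite (Y i) \<and> card (Y i) \<le> L"
  shows "card (\<Union>i\<in>I. PiE I (Y(i := X i))) \<le> card I * (d * L ^ (card I - 1))"
proof -
  have "card (\<Union>i\<in>I. PiE I (Y(i := X i))) \<le> (\<Sum>i\<in>I. card (PiE I (Y(i := X i))))"
    using \<open>finite I\<close> by (rule card_UN_le)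
  also have "\<dots> \<le> (\<Sum>i\<in>I. d * L ^ (card I - 1))"
  proof (rule sum_mono)
    fix i assume i: "i \<in> I"
    have "card (PiE I (Y(i := X i))) = (\<Prod>j\<in>I. card ((Y(i := X i)) j))"
      using \<open>finite I\<close> by (rule card_PiE)
    also have "\<dots> = card (X i) * (\<Prod>j\<in>I - {i}. card (Y j))"
      using \<open>finite I\<close> i by (subst prod.remove[of _ i]) (auto intro!: prod.cong)
    also have "\<dots> \<le> d * (\<Prod>j\<in>I - {i}. L)"
      using X[OF i] Y by (intro mult_le_mono prod_mono) auto
    also have "\<dots> = d * L ^ (card I - 1)" using i \<open>finite I\<close> by simp
    finally show "card (PiE I (Y(i := X i))) \<le> d * L ^ (card I - 1)" .
  qed
  finally show ?thesis by simp
qed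

text \<open>The common part cancels, and either difference contributes at most
  \<open>M * N\<close>.\<close>

lemma abs_sum_diff_le_card:
  fixes g :: "'a \<Rightarrow> real"
  assumes "finite A" "finite B" "\<And>x. \<bar>g x\<bar> \<le> M" "card (A - B) \<le> N" "card (B - A) \<le> N"
  shows "\<bar>sum g A - sum g B\<bar> \<le> 2 * M * real N"
proof -
  have M: "0 \<le> M" using assms(3) abs_ge_zero order_trans by blast
  have bound: "\<bar>sum g D\<bar> \<le> M * real N" if "card D \<le> N" for D
  proof -
    have "\<bar>sum g D\<bar> \<le> (\<Sum>x\<in>D. \<bar>g x\<bar>)" by (rule sum_abs)
    also have "\<dots> \<le> (\<Sum>x\<in>D. M)" by (intro sum_mono assms(3))
    also have "\<dots> \<le> M * real N" using that M by (simp add: mult.commute mult_left_mono)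
    finally show ?thesis .
  qed
  have "sum g A - sum g B = sum g (A - B) - sum g (B - A)"
    using sum.Int_Diff[OF assms(1), of g B] sum.Int_Diff[OF assms(2), of g A] by (simp add: Int_commute)
  also have "\<bar>\<dots>\<bar> \<le> \<bar>sum g (A - B)\<bar> + \<bar>sum g (B - A)\<bar>" by (rule abs_triangle_ineq4)
  also have "\<dots> \<le> M * real N + M * real N" by (intro add_mono bound assms)
  finally show ?thesis by simp
qed

text \<open>A box and its translate differ only near their faces: points are lost along the lower
  faces and gained along the upper ones, in slabs of thickness \<open>d\<close>.\<close>

lemma abs_sum_box_shift_le:
  fixes g :: "('i \<Rightarrow> int) \<Rightarrow> real" and a b w :: "'i \<Rightarrow> int"
  assumes "finite I" and w: "\<And>i. i \<in> I \<Longrightarrow> 0 \<le> w i \<and> w i \<le> int d"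
    and ab: "\<And>i. i \<in> I \<Longrightarrow> b i - a i \<le> int L" and M: "\<And>h. \<bar>g h\<bar> \<le> M"
  defines "H \<equiv> PiE I (\<lambda>i. {a i..<b i})"
  shows "\<bar>(\<Sum>h\<in>H. g (\<lambda>i\<in>I. h i + w i)) - (\<Sum>h\<in>H. g h)\<bar> \<le> 2 * M * real (card I * (d * L ^ (card I - 1)))"
proof -
  let ?\<tau> = "\<lambda>h. \<lambda>i\<in>I. h i + w i"
  have H: "finite H" unfolding H_def using \<open>finite I\<close> by (intro finite_PiE) auto
  have inj: "inj_on ?\<tau> H"
  proof (rule inj_onI)
    fix x y assume "x \<in> H" "y \<in> H" and eq: "?\<tau> x = ?\<tau> y"
    then show "x = y" unfolding H_def
      by (intro PiE_ext) (auto dest!: fun_cong simp: restrict_def split: if_splits)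
  qed
  \<comment> \<open>If no coordinate were close to its lower face, subtracting \<open>w\<close>
    would give a preimage in \<open>H\<close>.\<close>
  have "H - ?\<tau> ` H \<subseteq> (\<Union>i\<in>I. PiE I ((\<lambda>i. {a i..<b i})(i := {a i..<a i + int d})))"
  proof
    fix h assume h: "h \<in> H - ?\<tau> ` H"
    have "\<exists>i\<in>I. h i < a i + w i"
    proof (rule ccontr)
      assume "\<not> ?thesis"
      then have "(\<lambda>i\<in>I. h i - w i) \<in> H"
        using h w by (force simp: H_def PiE_iff)
      moreover have "h = ?\<tau> (\<lambda>i\<in>I. h i - w i)"
        using h by (auto simp: H_def PiE_iff extensional_def fun_eq_iff)
      ultimately show False using h by blast
    qed
    then obtain i where "i \<in> I" "h i < a i + w i" by blast
    moreover have "h j \<in> ((\<lambda>i. {a i..<b i})(i := {a i..<a i + int d})) j" if "j \<in> I" for j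
      using h w[OF that] that \<open>h i < a i + w i\<close> by (auto simp: H_def PiE_iff)
    ultimately show "h \<in> (\<Union>i\<in>I. PiE I ((\<lambda>i. {a i..<b i})(i := {a i..<a i + int d})))"
      using h by (intro UN_I[of i]) (auto simp: H_def PiE_iff)
  qed
  then have "card (H - ?\<tau> ` H) \<le> card (\<Union>i\<in>I. PiE I ((\<lambda>i. {a i..<b i})(i := {a i..<a i + int d})))"
    using \<open>finite I\<close> by (intro card_mono finite_UN_I finite_PiE) auto
  also have "\<dots> \<le> card I * (d * L ^ (card I - 1))"
    using \<open>finite I\<close> ab by (intro card_slabs_le) force+
  finally have c1: "card (H - ?\<tau> ` H) \<le> card I * (d * L ^ (card I - 1))" .
  \<comment> \<open>The remaining coordinates of such a point range over the translated sides, which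
    have the same length.\<close>
  have "?\<tau> ` H - H \<subseteq> (\<Union>i\<in>I. PiE I ((\<lambda>i. {a i + w i..<b i + w i})(i := {b i..<b i + int d})))"
  proof
    fix h assume "h \<in> ?\<tau> ` H - H"
    then obtain h' where h: "h' \<in> H" "h = ?\<tau> h'" "h \<notin> H" by blast
    then obtain i where i: "i \<in> I" "\<not> (a i \<le> h i \<and> h i < b i)" by (auto simp: H_def PiE_iff)
    then have "b i \<le> h i" using h w[of i] by (auto simp: H_def PiE_iff)
    moreover have "a j + w j \<le> h j" "h j < b j + w j" if "j \<in> I" for j
      using h that by (auto simp: H_def PiE_iff)
    moreover have "h \<in> extensional I" using h by simp
    ultimately show "h \<in> (\<Union>i\<in>I. PiE I ((\<lambda>i. {a i + w i..<b i + w i})(i := {b i..<b i + int d})))"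
      using i w[of i] by (intro UN_I[of i]) (force simp: PiE_iff)+
  qed
  then have "card (?\<tau> ` H - H) \<le> card (\<Union>i\<in>I. PiE I ((\<lambda>i. {a i + w i..<b i + w i})(i := {b i..<b i + int d})))"
    using \<open>finite I\<close> by (intro card_mono finite_UN_I finite_PiE) auto
  also have "\<dots> \<le> card I * (d * L ^ (card I - 1))"
    using \<open>finite I\<close> ab by (intro card_slabs_le) force+
  finally have c2: "card (?\<tau> ` H - H) \<le> card I * (d * L ^ (card I - 1))" .
  have "(\<Sum>h\<in>H. g (?\<tau> h)) = sum g (?\<tau> ` H)" by (simp add: sum.reindex[OF inj])
  then show ?thesis
    using abs_sum_diff_le_card[OF _ H M c2 c1] H by simp
qed

text \<open>By unique factorization \<open>T\<close> is determined by its product, a positive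
  integer not exceeding \<open>D\<close>.\<close>

lemma card_prod_primes_le:
  assumes "finite S" "\<And>p. p \<in> S \<Longrightarrow> prime p" "0 \<le> D"
  shows "real (card {T \<in> Pow S. real (\<Prod>T) \<le> D}) \<le> D"
proof -
  let ?P = "{T \<in> Pow S. real (\<Prod>T) \<le> D}"
  have mem: "p \<in> T \<longleftrightarrow> prime p \<and> p dvd \<Prod>T" if "T \<in> Pow S" for T p
  proof -
    have "finite T" using that assms(1) finite_subset by blast
    then show ?thesis
      using that assms(2) by (auto simp: prime_dvd_prod_iff) (metis primes_dvd_imp_eq subsetD)
  qed
  have "inj_on (\<lambda>T. \<Prod>T) ?P"
  proof (rule inj_onI)
    fix T T' assume "T \<in> ?P" "T' \<in> ?P" "\<Prod>T = \<Prod>T'"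
    then show "T = T'" using mem by (intro set_eqI) auto
  qed
  moreover have "(\<lambda>T. \<Prod>T) ` ?P \<subseteq> {1..nat \<lfloor>D\<rfloor>}"
  proof
    fix n assume "n \<in> (\<lambda>T. \<Prod>T) ` ?P"
    then obtain T where T: "n = \<Prod>T" "T \<subseteq> S" "real n \<le> D" by auto
    have "0 < p" if "p \<in> T" for p using that T(2) assms(2)[of p] prime_gt_0_nat by blast
    then have "0 < n" unfolding T(1) by (rule prod_pos)
    then show "n \<in> {1..nat \<lfloor>D\<rfloor>}" using le_nat_floor[OF T(3)] by simp
  qed
  ultimately have "card ?P \<le> nat \<lfloor>D\<rfloor>"
    using card_inj_on_le[of "\<lambda>T. \<Prod>T" ?P "{1..nat \<lfloor>D\<rfloor>}"] by simp
  then show ?thesis using assms(3) by linarith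
qed

context residue_sets
begin

text \<open>Mean zero at one prime \<open>p \<in> T\<close> is enough. Translations by multiples of
  \<open>m\<close>, the product of the other primes, leave the other factors unchanged while the
  factor at \<open>p\<close> averages to zero. Since they move the box by at most
  \<open>\<Prod>T\<close>, only a boundary layer remains; its thickness and the bound
  \<open>\<Prod>T ^ (k - 1)\<close> for the terms give the power \<open>k\<close>.\<close>

lemma abs_sum_prod_excess_le:
  fixes a b :: "nat \<Rightarrow> int"
  assumes T: "finite T" "T \<noteq> {}" "\<And>p. p \<in> T \<Longrightarrow> prime p" and k: "1 \<le> k"
    and ab: "\<And>i. i \<in> {1..<k} \<Longrightarrow> b i - a i \<le> int L"
  shows "\<bar>\<Sum>h\<in>PiE {1..<k} (\<lambda>i. {a i..<b i}). \<Prod>p\<in>T. excess \<Omega> k h p\<bar>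
       \<le> 2 * real (k - 1) * real (\<Prod>T) ^ k * real L ^ (k - 2)"
proof -
  obtain p where p: "p \<in> T" using T by blast
  define m where "m = \<Prod>(T - {p})"
  define H where "H = PiE {1..<k} (\<lambda>i. {a i..<b i})"
  define W where "W = PiE {1..<k} (\<lambda>_::nat. {0..<int p})"
  define g where "g h = (\<Prod>p\<in>T. excess \<Omega> k h p)" for h
  define \<tau> where "\<tau> w h = (\<lambda>i\<in>{1..<k}. h i + int m * w i)" for w h :: "nat \<Rightarrow> int"
  have d: "\<Prod>T = p * m" unfolding m_def using T(1) p by (simp add: prod.remove)
  have cop: "coprime (int m) (int p)"
    unfolding coprime_int_iff m_def using T p by (intro prod_coprime_left primes_coprime) auto
  have m_dvd: "int p' dvd int m" if "p' \<in> T - {p}" for p'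
    unfolding m_def using T(1) that by (auto simp only: int_dvd_int_iff intro!: dvd_prodI finite_Diff)
  have Wpos: "0 < card W"
    unfolding W_def using prime_gt_0_nat[OF T(3)[OF p]] by (simp add: card_PiE)
  have bound: "\<bar>g h\<bar> \<le> real (\<Prod>T) ^ (k - 1)" for h
  proof -
    have "\<bar>g h\<bar> = (\<Prod>p\<in>T. \<bar>excess \<Omega> k h p\<bar>)" by (simp add: g_def abs_prod)
    also have "\<dots> \<le> (\<Prod>p\<in>T. real p ^ (k - 1))"
      using T k by (intro prod_mono) (auto intro!: abs_excess_le[simplified])
    finally show ?thesis by (simp add: prod_power_distrib)
  qed
  have "(\<Sum>w\<in>W. g (\<tau> w h)) = 0" for h
  proof -
    have "g (\<tau> w h) = excess \<Omega> k (\<lambda>i. h i + int m * w i) p * (\<Prod>p\<in>T - {p}. excess \<Omega> k h p)" for w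
    proof -
      have "excess \<Omega> k (\<tau> w h) p = excess \<Omega> k (\<lambda>i. h i + int m * w i) p"
        by (intro excess_cong) (auto simp: \<tau>_def)
      moreover have "excess \<Omega> k (\<tau> w h) p' = excess \<Omega> k h p'" if "p' \<in> T - {p}" for p'
        using m_dvd[OF that] by (intro excess_cong) (auto simp: \<tau>_def mod_eq_dvd_iff)
      ultimately show ?thesis unfolding g_def using T(1) p by (simp add: prod.remove[of T p])
    qed
    then show ?thesis
      using sum_excess_affine[OF T(3)[OF p] cop k] by (simp add: W_def flip: sum_distrib_right)
  qed
  then have "(\<Sum>w\<in>W. \<Sum>h\<in>H. g (\<tau> w h)) = 0" by (subst sum.swap) simp
  \<comment> \<open>As the translated sums cancel in total, the sum over \<open>H\<close> is an
    average of differences that live near the boundary.\<close>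
  then have "real (card W) * \<bar>\<Sum>h\<in>H. g h\<bar> = \<bar>\<Sum>w\<in>W. (\<Sum>h\<in>H. g (\<tau> w h)) - (\<Sum>h\<in>H. g h)\<bar>"
    by (simp add: sum_subtractf abs_mult)
  also have "\<dots> \<le> (\<Sum>w\<in>W. \<bar>(\<Sum>h\<in>H. g (\<tau> w h)) - (\<Sum>h\<in>H. g h)\<bar>)" by (rule sum_abs)
  also have "\<dots> \<le> (\<Sum>w\<in>W. 2 * real (\<Prod>T) ^ (k - 1) * real (card {1..<k} * (\<Prod>T * L ^ (card {1..<k} - 1))))"
  proof (rule sum_mono)
    fix w assume w: "w \<in> W"
    have "0 \<le> int m * w i \<and> int m * w i \<le> int (\<Prod>T)" if "i \<in> {1..<k}" for i
    proof -
      have "0 \<le> w i" "w i \<le> int p" using w that by (force simp: W_def PiE_iff)+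
      then show ?thesis unfolding d by (simp add: mult.commute[of "int p"] mult_left_mono)
    qed
    then show "\<bar>(\<Sum>h\<in>H. g (\<tau> w h)) - (\<Sum>h\<in>H. g h)\<bar>
        \<le> 2 * real (\<Prod>T) ^ (k - 1) * real (card {1..<k} * (\<Prod>T * L ^ (card {1..<k} - 1)))"
      unfolding H_def \<tau>_def using ab bound by (intro abs_sum_box_shift_le) auto
  qed
  also have "\<dots> = real (card W) * (2 * real (k - 1) * real (\<Prod>T) ^ k * real L ^ (k - 2))"
  proof -
    have "real (\<Prod>T) ^ k = real (\<Prod>T) ^ (k - 1) * real (\<Prod>T)"
      using k by (cases k) (auto simp: mult.commute)
    moreover have "k - 1 - 1 = k - 2" by simp
    ultimately show ?thesis by (simp add: mult_ac del: of_nat_prod)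
  qed
  finally show ?thesis using Wpos unfolding H_def g_def by simp
qed

end

text \<open>Expand over the subsets \<open>T\<close> of \<open>S\<close>. The empty set gives
  \<open>card H\<close>, products up to \<open>D\<close> are treated by mean zero, and larger ones
  receive the Rankin weight \<open>(\<Prod>T / D) powr \<alpha> \<ge> 1\<close>. The threshold
  \<open>D\<close> stays free, to be chosen as a power of the spacing.\<close>

lemma (in poisson_family) abs_sum_minus_card_le:
  fixes a b :: "nat \<Rightarrow> int"
  assumes S: "finite S" "\<And>p. p \<in> S \<Longrightarrow> prime p" and D: "0 < D"
    and ab: "\<And>i. i \<in> {1..<k} \<Longrightarrow> b i - a i \<le> int L"
  defines "H \<equiv> PiE {1..<k} (\<lambda>i. {a i..<b i})"
  shows "\<bar>(\<Sum>h\<in>H. \<Prod>p\<in>S. 1 + excess \<Omega> k h p) - real (card H)\<bar>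
       \<le> 2 * real (k - 1) * D ^ (k + 1) * real L ^ (k - 2)
         + D powr (- \<alpha>) * (\<Sum>h\<in>H. \<Prod>p\<in>S. 1 + real p powr \<alpha> * \<bar>excess \<Omega> k h p\<bar>)"
proof -
  define f where "f T = (\<Sum>h\<in>H. \<Prod>p\<in>T. excess \<Omega> k h p)" for T
  define P where "P = {T \<in> Pow S. real (\<Prod>T) \<le> D}"
  define E where "E = 2 * real (k - 1) * D ^ k * real L ^ (k - 2)"
  have E0: "0 \<le> E" using D by (simp add: E_def)
  have finP: "finite (Pow S)" using S by simp
  have finT: "finite T" "\<And>p. p \<in> T \<Longrightarrow> prime p" if "T \<in> Pow S" for T
    using that S finite_subset by blast+
  have "(\<Sum>h\<in>H. \<Prod>p\<in>S. 1 + excess \<Omega> k h p) = (\<Sum>h\<in>H. \<Sum>T\<in>Pow S. \<Prod>p\<in>T. excess \<Omega> k h p)"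
    using S by (subst add.commute, subst prod_add) auto
  also have "\<dots> = (\<Sum>T\<in>Pow S. f T)" unfolding f_def by (rule sum.swap)
  also have "\<dots> = f {} + (\<Sum>T\<in>Pow S - {{}}. f T)" using finP by (intro sum.remove) auto
  finally have "\<bar>(\<Sum>h\<in>H. \<Prod>p\<in>S. 1 + excess \<Omega> k h p) - real (card H)\<bar> = \<bar>\<Sum>T\<in>Pow S - {{}}. f T\<bar>"
    by (simp add: f_def)
  also have "\<dots> \<le> (\<Sum>T\<in>Pow S - {{}}. \<bar>f T\<bar>)" by (rule sum_abs)
  \<comment> \<open>The Rankin term is charged to every \<open>T\<close>, so that it can be refolded
    into a product over \<open>S\<close>.\<close>
  also have "\<dots> \<le> (\<Sum>T\<in>Pow S - {{}}. (if T \<in> P then E else 0)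
      + (\<Sum>h\<in>H. D powr (- \<alpha>) * (\<Prod>p\<in>T. real p powr \<alpha> * \<bar>excess \<Omega> k h p\<bar>)))" (is "_ \<le> (\<Sum>T\<in>_. _ + ?R T)")
  proof (rule sum_mono)
    fix T assume T: "T \<in> Pow S - {{}}"
    have R0: "0 \<le> ?R T" using D by (intro sum_nonneg mult_nonneg_nonneg prod_nonneg) auto
    have pos: "0 < real p" if "p \<in> T" for p using finT(2)[of T p] T that prime_gt_0_nat by auto
    show "\<bar>f T\<bar> \<le> (if T \<in> P then E else 0) + ?R T"
    proof (cases "T \<in> P")
      case True
      have "\<bar>f T\<bar> \<le> 2 * real (k - 1) * real (\<Prod>T) ^ k * real L ^ (k - 2)"
        unfolding f_def H_def using T finT k ab by (intro abs_sum_prod_excess_le) auto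
      also have "\<dots> \<le> E"
        unfolding E_def using True by (intro mult_right_mono mult_left_mono power_mono) (auto simp: P_def simp del: of_nat_prod)
      finally show ?thesis using True R0 by simp
    next
      case False
      then have "D \<le> (\<Prod>p\<in>T. real p)" using T by (auto simp: P_def)
      then have "D powr \<alpha> \<le> (\<Prod>p\<in>T. real p) powr \<alpha>"
        using D alpha by (intro powr_mono2) auto
      also have "\<dots> = (\<Prod>p\<in>T. real p powr \<alpha>)"
        using pos by (intro prod_powr_distrib less_imp_le)
      finally have "D powr (- \<alpha>) * D powr \<alpha> \<le> D powr (- \<alpha>) * (\<Prod>p\<in>T. real p powr \<alpha>)"
        by (intro mult_left_mono) auto
      then have *: "1 \<le> D powr (- \<alpha>) * (\<Prod>p\<in>T. real p powr \<alpha>)"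
        using D by (simp flip: powr_add)
      have "\<bar>f T\<bar> \<le> (\<Sum>h\<in>H. \<bar>\<Prod>p\<in>T. excess \<Omega> k h p\<bar>)" unfolding f_def by (rule sum_abs)
      also have "\<dots> \<le> ?R T"
      proof (rule sum_mono)
        fix h
        have "1 * \<bar>\<Prod>p\<in>T. excess \<Omega> k h p\<bar>
            \<le> (D powr (- \<alpha>) * (\<Prod>p\<in>T. real p powr \<alpha>)) * \<bar>\<Prod>p\<in>T. excess \<Omega> k h p\<bar>"
          using * by (rule mult_right_mono) auto
        then show "\<bar>\<Prod>p\<in>T. excess \<Omega> k h p\<bar>
            \<le> D powr (- \<alpha>) * (\<Prod>p\<in>T. real p powr \<alpha> * \<bar>excess \<Omega> k h p\<bar>)"
          by (simp add: abs_prod prod.distrib mult.assoc)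
      qed
      finally show ?thesis using False by simp
    qed
  qed
  also have "\<dots> \<le> (\<Sum>T\<in>Pow S. (if T \<in> P then E else 0) + ?R T)"
    using finP D E0 by (intro sum_mono2) (auto intro!: add_nonneg_nonneg sum_nonneg mult_nonneg_nonneg prod_nonneg)
  also have "\<dots> = real (card P) * E
      + (\<Sum>h\<in>H. D powr (- \<alpha>) * (\<Sum>T\<in>Pow S. \<Prod>p\<in>T. real p powr \<alpha> * \<bar>excess \<Omega> k h p\<bar>))"
  proof -
    have "Pow S \<inter> {T. T \<in> P} = P" by (auto simp: P_def)
    then have "(\<Sum>T\<in>Pow S. if T \<in> P then E else 0) = real (card P) * E"
      using finP by (simp add: sum.If_cases)
    moreover have "(\<Sum>T\<in>Pow S. ?R T)
        = (\<Sum>h\<in>H. D powr (- \<alpha>) * (\<Sum>T\<in>Pow S. \<Prod>p\<in>T. real p powr \<alpha> * \<bar>excess \<Omega> k h p\<bar>))"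
      by (subst sum.swap) (simp add: sum_distrib_left)
    ultimately show ?thesis by (simp only: sum.distrib)
  qed
  \<comment> \<open>There are at most \<open>D\<close> small products, each of cost \<open>E\<close>
    with its factor \<open>D ^ k\<close>; this is the source of the exponent
    \<open>k + 1\<close>.\<close>
  also have "\<dots> \<le> D * E + D powr (- \<alpha>) * (\<Sum>h\<in>H. \<Prod>p\<in>S. 1 + real p powr \<alpha> * \<bar>excess \<Omega> k h p\<bar>)"
  proof (intro add_mono mult_right_mono E0)
    show "real (card P) \<le> D" unfolding P_def using S D by (intro card_prod_primes_le) auto
    have "(\<Sum>T\<in>Pow S. \<Prod>p\<in>T. real p powr \<alpha> * \<bar>excess \<Omega> k h p\<bar>)
        = (\<Prod>p\<in>S. 1 + real p powr \<alpha> * \<bar>excess \<Omega> k h p\<bar>)" for h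
      using prod_add[OF S(1), of "\<lambda>p. real p powr \<alpha> * \<bar>excess \<Omega> k h p\<bar>" "\<lambda>_. 1"]
      by (simp add: add.commute)
    then show "(\<Sum>h\<in>H. D powr (- \<alpha>) * (\<Sum>T\<in>Pow S. \<Prod>p\<in>T. real p powr \<alpha> * \<bar>excess \<Omega> k h p\<bar>))
        \<le> D powr (- \<alpha>) * (\<Sum>h\<in>H. \<Prod>p\<in>S. 1 + real p powr \<alpha> * \<bar>excess \<Omega> k h p\<bar>)"
      by (simp add: sum_distrib_left)
  qed
  also have "D * E = 2 * real (k - 1) * D ^ (k + 1) * real L ^ (k - 2)" by (simp add: E_def)
  finally show ?thesis .
qed

section \<open>Correlations of boxes\<close>

lemma eventually_spacing_at_top:
  "eventually (\<lambda>q. squarefree q \<and> s\<^sub>0 \<le> spacing q (crt_set \<Omega> q)) (spacing_at_top \<Omega>)"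
  unfolding spacing_at_top_def eventually_inf_principal
  by (rule eventually_mono[OF eventually_filtercomapI[OF eventually_ge_at_top]]) auto

lemma filterlim_spacing_at_top:
  "filterlim (\<lambda>q. spacing q (crt_set \<Omega> q)) at_top (spacing_at_top \<Omega>)"
  unfolding spacing_at_top_def
  by (rule filterlim_mono[OF filterlim_filtercomap order_refl inf_le1])

section \<open>Lattice points in dilated boxes\<close>

text \<open>With half-open sides, rounding up at both ends is exact: an integer satisfies
  \<open>x \<le> h\<close> iff \<open>\<lceil>x\<rceil> \<le> h\<close>, and \<open>h < y\<close>
  iff \<open>h < \<lceil>y\<rceil>\<close>.\<close>

lemma dilate_lattice_points_box:
  assumes "0 < s"
  shows "dilate_lattice_points k s (PiE {1..<k} (\<lambda>i. {a i..<a i + w}))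
       = PiE {1..<k} (\<lambda>i. {\<lceil>s * a i\<rceil>..<\<lceil>s * (a i + w)\<rceil>})"
proof (intro equalityI subsetI)
  fix h assume "h \<in> dilate_lattice_points k s (PiE {1..<k} (\<lambda>i. {a i..<a i + w}))"
  then obtain x where h: "h \<in> {1..<k} \<rightarrow>\<^sub>E UNIV" and "x \<in> PiE {1..<k} (\<lambda>i. {a i..<a i + w})"
    and hx: "\<And>i. i \<in> {1..<k} \<Longrightarrow> real_of_int (h i) = s * x i"
    unfolding dilate_lattice_points_def by blast
  then have x: "a i \<le> x i \<and> x i < a i + w" if "i \<in> {1..<k}" for i using that by (force simp: PiE_iff)
  have "\<lceil>s * a i\<rceil> \<le> h i \<and> h i < \<lceil>s * (a i + w)\<rceil>" if "i \<in> {1..<k}" for i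
    using x[OF that] hx[OF that] assms by (simp add: ceiling_le_iff less_ceiling_iff)
  with h show "h \<in> PiE {1..<k} (\<lambda>i. {\<lceil>s * a i\<rceil>..<\<lceil>s * (a i + w)\<rceil>})" by (simp add: PiE_iff)
next
  fix h assume h: "h \<in> PiE {1..<k} (\<lambda>i. {\<lceil>s * a i\<rceil>..<\<lceil>s * (a i + w)\<rceil>})"
  have "a i \<le> h i / s \<and> h i / s < a i + w" if "i \<in> {1..<k}" for i
  proof -
    have "\<lceil>s * a i\<rceil> \<le> h i" "h i < \<lceil>s * (a i + w)\<rceil>" using h that by (auto simp: PiE_iff)
    then show ?thesis using assms by (auto simp: ceiling_le_iff less_ceiling_iff field_simps)
  qed
  then have "(\<lambda>i\<in>{1..<k}. h i / s) \<in> PiE {1..<k} (\<lambda>i. {a i..<a i + w})" by auto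
  then show "h \<in> dilate_lattice_points k s (PiE {1..<k} (\<lambda>i. {a i..<a i + w}))"
    using h assms unfolding dilate_lattice_points_def
    by (intro CollectI conjI bexI[of _ "\<lambda>i\<in>{1..<k}. h i / s"]) (auto simp: PiE_iff)
qed

lemma tendsto_ceiling_diff_div:
  assumes "0 < w"
  shows "((\<lambda>s. real (card {\<lceil>s * a\<rceil>..<\<lceil>s * (a + w)\<rceil>}) / s) \<longlongrightarrow> w) at_top"
proof (rule tendsto_sandwich)
  show "eventually (\<lambda>s. w - 1 / s \<le> real (card {\<lceil>s * a\<rceil>..<\<lceil>s * (a + w)\<rceil>}) / s) at_top"
    using eventually_gt_at_top[of 0]
  proof eventually_elim
    case (elim s)
    have "s * w - 1 \<le> real (card {\<lceil>s * a\<rceil>..<\<lceil>s * (a + w)\<rceil>})"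
      using ceiling_correct[of "s * a"] ceiling_correct[of "s * (a + w)"] by (simp add: algebra_simps) linarith
    then have "(s * w - 1) / s \<le> real (card {\<lceil>s * a\<rceil>..<\<lceil>s * (a + w)\<rceil>}) / s"
      using elim by (intro divide_right_mono) auto
    then show ?case using elim by (simp add: diff_divide_distrib)
  qed
  show "eventually (\<lambda>s. real (card {\<lceil>s * a\<rceil>..<\<lceil>s * (a + w)\<rceil>}) / s \<le> w + 1 / s) at_top"
    using eventually_gt_at_top[of 0]
  proof eventually_elim
    case (elim s)
    \<comment> \<open>The order of the ceilings makes the cardinality their difference, instead of
      one truncated to zero.\<close>
    then have "s * a \<le> s * (a + w)" using assms by simp
    then have "\<lceil>s * a\<rceil> \<le> \<lceil>s * (a + w)\<rceil>" by (rule ceiling_mono)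
    then have "real (card {\<lceil>s * a\<rceil>..<\<lceil>s * (a + w)\<rceil>})
        = real_of_int \<lceil>s * (a + w)\<rceil> - real_of_int \<lceil>s * a\<rceil>" by simp
    also have "\<dots> \<le> s * w + 1"
      using ceiling_correct[of "s * a"] ceiling_correct[of "s * (a + w)"] distrib_left[of s a w] by linarith
    finally have "real (card {\<lceil>s * a\<rceil>..<\<lceil>s * (a + w)\<rceil>}) \<le> s * w + 1" .
    then have "real (card {\<lceil>s * a\<rceil>..<\<lceil>s * (a + w)\<rceil>}) / s \<le> (s * w + 1) / s"
      using elim by (intro divide_right_mono) auto
    then show ?case using elim by (simp add: add_divide_distrib)
  qed
  have "((\<lambda>s::real. 1 / s) \<longlongrightarrow> 0) at_top"
    using tendsto_inverse_0_at_top[OF filterlim_ident] by (simp add: inverse_eq_divide)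
  from tendsto_diff[OF tendsto_const this, of w] tendsto_add[OF tendsto_const this, of w]
  show "((\<lambda>s. w - 1 / s) \<longlongrightarrow> w) at_top" "((\<lambda>s. w + 1 / s) \<longlongrightarrow> w) at_top" by auto
qed

lemma tendsto_card_dilated_box:
  assumes "0 < w"
  shows "((\<lambda>s. real (card (PiE {1..<k} (\<lambda>i. {\<lceil>s * a i\<rceil>..<\<lceil>s * (a i + w)\<rceil>}))) / s ^ (k - 1)) \<longlongrightarrow> w ^ (k - 1)) at_top"
proof -
  have "((\<lambda>s. \<Prod>i\<in>{1..<k}. real (card {\<lceil>s * a i\<rceil>..<\<lceil>s * (a i + w)\<rceil>}) / s) \<longlongrightarrow> (\<Prod>i\<in>{1..<k}. w)) at_top"
    using assms by (intro tendsto_prod tendsto_ceiling_diff_div)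
  moreover have "(\<Prod>i\<in>{1..<k}. real (card {\<lceil>s * a i\<rceil>..<\<lceil>s * (a i + w)\<rceil>}) / s)
      = real (card (PiE {1..<k} (\<lambda>i. {\<lceil>s * a i\<rceil>..<\<lceil>s * (a i + w)\<rceil>}))) / s ^ (k - 1)" for s
    by (simp add: card_PiE prod_dividef del: card_atLeastLessThan_int)
  ultimately show ?thesis by simp
qed

text \<open>Coordinates of a box vary independently, so \<open>x\<close> and \<open>y\<close> occur
  together in one point of the box, with \<open>a l\<close> elsewhere. The alternative
  \<open>i = 0\<close> compares with the origin.\<close>

lemma strict_box_in_ordered_cone:
  assumes Q: "PiE {1..<k} (\<lambda>i. {a i..<a i + w}) \<subseteq> ordered_cone k" and "0 < w"
    and ij: "i < j" "j < k" and y: "a j \<le> y" "y < a j + w"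
    and x: "x = 0 \<and> i = 0 \<or> 0 < i \<and> a i \<le> x \<and> x < a i + w"
  shows "x < y"
proof -
  define z where "z = (\<lambda>l\<in>{1..<k}. if l = j then y else if l = i then x else a l)"
  have "z \<in> PiE {1..<k} (\<lambda>i. {a i..<a i + w})"
    using x y \<open>0 < w\<close> by (auto simp: z_def)
  with Q have "strict_mono_on {..<k} (z(0 := 0))" by (auto simp: ordered_cone_def)
  then have "(z(0 := 0)) i < (z(0 := 0)) j"
    using ij by (auto simp: strict_mono_on_def)
  then show ?thesis using x ij by (auto simp: z_def split: if_splits)
qed

context poisson_family
begin

text \<open>The weighted lattice sum over \<open>H\<close> differs from \<open>card (H s)\<close> by
  a power saving in the spacing, and \<open>card (H s)\<close> is asymptotic to
  \<open>(s * w) ^ (k - 1)\<close>. Containment in the cone keeps the points of every lattice vector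
  apart.\<close>

lemma correlation_box_tendsto:
  assumes "0 < w" and Q: "PiE {1..<k} (\<lambda>i. {a i..<a i + w}) \<subseteq> ordered_cone k"
  shows "((\<lambda>q. correlation k (PiE {1..<k} (\<lambda>i. {a i..<a i + w})) q (crt_set \<Omega> q)) \<longlongrightarrow> w ^ (k - 1))
           (spacing_at_top \<Omega>)"
proof -
  let ?Q = "PiE {1..<k} (\<lambda>i. {a i..<a i + w})"
  define H where "H s = PiE {1..<k} (\<lambda>i. {\<lceil>s * a i\<rceil>..<\<lceil>s * (a i + w)\<rceil>})" for s
  \<comment> \<open>A bound for all right endpoints. As it is at least \<open>1\<close>, rounding
    \<open>B * s q\<close> up to \<open>L\<close> costs at most a factor \<open>2\<close>.\<close>
  define B where "B = Max (insert 1 ((\<lambda>i. a i + w) ` {1..<k}))"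
  have B: "1 \<le> B" "\<And>i. i \<in> {1..<k} \<Longrightarrow> a i + w \<le> B" unfolding B_def by (auto intro!: Max_ge simp del: Max_insert)
  \<comment> \<open>With \<open>D = s powr \<beta>\<close> the boundary term has
    \<open>D ^ (k + 1) = s powr (1 / 2)\<close>, less than the factor \<open>s\<close> it saves. By
    the choice of \<open>\<eta>\<close>, \<open>D powr (- \<alpha>)\<close> is
    \<open>s powr (- (2 * \<eta>))\<close>, which outweighs the loss
    \<open>s powr \<eta>\<close>.\<close>
  define \<beta> where "\<beta> = 1 / (2 * real (k + 1))"
  define \<eta> where "\<eta> = \<alpha> * \<beta> / 2"
  have beta: "0 < \<beta>" "\<beta> * real (k + 1) = 1 / 2" by (auto simp: \<beta>_def)
  have eta: "0 < \<eta>" using beta alpha by (simp add: \<eta>_def)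
  obtain M where M: "0 \<le> M" "\<And>S L (I :: nat \<Rightarrow> int set). finite S \<Longrightarrow> (\<forall>p\<in>S. prime p) \<Longrightarrow>
      (\<forall>i j x y. i < j \<longrightarrow> j < k \<longrightarrow> x \<in> (I(0 := {0})) i \<longrightarrow> y \<in> I j \<longrightarrow> x \<noteq> y \<and> \<bar>y - x\<bar> \<le> int L) \<Longrightarrow>
      (\<Sum>h\<in>PiE {1..<k} I. \<Prod>p\<in>S. 1 + real p powr \<alpha> * \<bar>excess \<Omega> k h p\<bar>)
        \<le> M * real L ^ (k - 1) * (\<Prod>p\<in>S. \<sigma> p) powr \<eta>"
    using sum_weighted_excess_bound[OF eta] by blast
  define c where "c s = 2 * real (k - 1) * (2 * B) ^ (k - 2) * s powr (- (1 / 2))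
      + M * (2 * B) ^ (k - 1) * s powr (- \<eta>)" for s :: real
  define s where "s q = spacing q (crt_set \<Omega> q)" for q
  have bound: "\<bar>correlation k ?Q q (crt_set \<Omega> q) - real (card (H (s q))) / s q ^ (k - 1)\<bar> \<le> c (s q)"
    if q: "squarefree q" "1 \<le> s q" for q
  proof -
    define S where "S = prime_factors q"
    define L where "L = nat \<lceil>B * s q\<rceil>"
    have S: "finite S" "\<And>p. p \<in> S \<Longrightarrow> prime p" by (auto simp: S_def)
    have s: "s q = (\<Prod>p\<in>S. \<sigma> p)" using spacing_crt_set[OF q(1)] by (simp add: s_def S_def)
    have Bs: "1 \<le> B * s q" using mult_mono[OF B(1) q(2)] B by simp
    have L: "B * s q \<le> real L" "real L \<le> 2 * B * s q" using Bs unfolding L_def by linarith+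
    define I where "I i = {\<lceil>s q * a i\<rceil>..<\<lceil>s q * (a i + w)\<rceil>}" for i
    have I: "a i \<le> x / s q \<and> x / s q < a i + w" if "x \<in> I i" for i x
    proof -
      have "\<lceil>s q * a i\<rceil> \<le> x" "x < \<lceil>s q * (a i + w)\<rceil>" using that by (auto simp: I_def)
      then show ?thesis using q(2) by (auto simp: ceiling_le_iff less_ceiling_iff field_simps)
    qed
    have lt: "x < y" if "i < j" "j < k" "x \<in> (I(0 := {0})) i" "y \<in> I j" for i j x y
    proof -
      have "x / s q = 0 \<and> i = 0 \<or> 0 < i \<and> a i \<le> x / s q \<and> x / s q < a i + w"
        using that I by (cases "i = 0") auto
      then have "x / s q < y / s q"
        using strict_box_in_ordered_cone[OF Q \<open>0 < w\<close> that(1,2), of "y / s q" "x / s q"] I[OF that(4)] by blast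
      then show ?thesis using q(2) by (simp add: divide_less_cancel)
    qed
    have nonneg: "0 \<le> x" if "i < k" "x \<in> (I(0 := {0})) i" for i x
      using lt[of 0 i 0 x] that by (cases "i = 0") auto
    have le: "y \<le> int L" if "0 < j" "j < k" "y \<in> I j" for j y
    proof -
      have "y / s q < B" using I[OF that(3)] B(2)[of j] that by simp
      then have "real_of_int y < B * s q" using q(2) by (simp add: field_simps)
      then show ?thesis using L(1) by linarith
    qed
    \<comment> \<open>Both entries are nonnegative and the larger is at most \<open>L\<close>, so
      their difference is too.\<close>
    have sep: "\<forall>i j x y. i < j \<longrightarrow> j < k \<longrightarrow> x \<in> (I(0 := {0})) i \<longrightarrow> y \<in> I j \<longrightarrow> x \<noteq> y \<and> \<bar>y - x\<bar> \<le> int L"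
    proof (intro allI impI)
      fix i j x y assume "i < j" "j < k" "x \<in> (I(0 := {0})) i" "y \<in> I j"
      then show "x \<noteq> y \<and> \<bar>y - x\<bar> \<le> int L"
        using lt[of i j x y] nonneg[of i x] le[of j y] by auto
    qed
    have width: "\<lceil>s q * (a i + w)\<rceil> - \<lceil>s q * a i\<rceil> \<le> int L" if "i \<in> {1..<k}" for i
    proof -
      \<comment> \<open>The lower corner is compared with the origin at index
        \<open>0\<close>.\<close>
      have "0 < a i"
        using strict_box_in_ordered_cone[OF Q \<open>0 < w\<close>, of 0 i "a i" 0] that \<open>0 < w\<close> by auto
      then have "0 \<le> s q * a i" using q(2) by simp
      then have "0 \<le> \<lceil>s q * a i\<rceil>" by linarith
      moreover have "s q * (a i + w) \<le> s q * B"
        using B(2)[OF that] q(2) by (intro mult_left_mono) auto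
      then have "s q * (a i + w) \<le> real L" using L(1) by (simp add: mult.commute)
      then have "\<lceil>s q * (a i + w)\<rceil> \<le> int L" by (simp add: ceiling_le_iff)
      ultimately show ?thesis by linarith
    qed
    define D where "D = s q powr \<beta>"
    have D: "0 < D" "D powr (- \<alpha>) * s q powr \<eta> = s q powr (- \<eta>)" "D ^ (k + 1) = s q powr (1 / 2)"
    proof -
      show "0 < D" using q(2) by (simp add: D_def)
      have "D powr (- \<alpha>) * s q powr \<eta> = s q powr (\<beta> * (- \<alpha>) + \<eta>)"
        by (simp only: D_def powr_powr powr_add)
      also have "\<beta> * (- \<alpha>) + \<eta> = - \<eta>" by (simp add: \<eta>_def)
      finally show "D powr (- \<alpha>) * s q powr \<eta> = s q powr (- \<eta>)" .
      have "D ^ (k + 1) = D powr real (k + 1)" using \<open>0 < D\<close> by (rule powr_realpow[symmetric])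
      also have "\<dots> = s q powr (1 / 2)" unfolding D_def powr_powr beta(2) ..
      finally show "D ^ (k + 1) = s q powr (1 / 2)" .
    qed
    have "\<bar>(\<Sum>h\<in>H (s q). \<Prod>p\<in>S. 1 + excess \<Omega> k h p) - real (card (H (s q)))\<bar>
        \<le> 2 * real (k - 1) * D ^ (k + 1) * real L ^ (k - 2)
          + D powr (- \<alpha>) * (\<Sum>h\<in>H (s q). \<Prod>p\<in>S. 1 + real p powr \<alpha> * \<bar>excess \<Omega> k h p\<bar>)"
      unfolding H_def by (intro abs_sum_minus_card_le S D width)
    also have "\<dots> \<le> 2 * real (k - 1) * D ^ (k + 1) * real L ^ (k - 2)
          + D powr (- \<alpha>) * (M * real L ^ (k - 1) * s q powr \<eta>)"
    proof (intro add_mono order_refl mult_left_mono)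
      have "H (s q) = PiE {1..<k} I" unfolding H_def by (intro PiE_cong) (simp add: I_def)
      then show "(\<Sum>h\<in>H (s q). \<Prod>p\<in>S. 1 + real p powr \<alpha> * \<bar>excess \<Omega> k h p\<bar>) \<le> M * real L ^ (k - 1) * s q powr \<eta>"
        using M(2)[OF _ _ sep, of S] S by (simp add: s)
    qed simp
    also have "\<dots> = 2 * real (k - 1) * s q powr (1 / 2) * real L ^ (k - 2) + M * real L ^ (k - 1) * s q powr (- \<eta>)"
      unfolding D(3) D(2)[symmetric] by (simp add: mult_ac)
    also have "\<dots> \<le> 2 * real (k - 1) * s q powr (1 / 2) * (2 * B * s q) ^ (k - 2)
          + M * (2 * B * s q) ^ (k - 1) * s q powr (- \<eta>)"
      using L(2) M(1) by (intro add_mono mult_left_mono mult_right_mono power_mono) auto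
    also have "\<dots> = c (s q) * s q ^ (k - 1)"
    proof -
      have k1: "k - 1 = Suc (k - 2)" using k by simp
      have "s q powr (1 / 2) = s q powr (- (1 / 2)) * s q"
        using q(2) by (simp add: powr_mult_base mult.commute[of _ "s q"] del: powr_minus)
      then show ?thesis
        unfolding c_def k1 by (simp add: power_mult_distrib algebra_simps del: powr_minus)
    qed
    finally have "\<bar>(\<Sum>h\<in>H (s q). \<Prod>p\<in>S. 1 + excess \<Omega> k h p) - real (card (H (s q)))\<bar> / s q ^ (k - 1) \<le> c (s q)"
      using q(2) by (simp add: pos_divide_le_eq)
    moreover have "correlation k ?Q q (crt_set \<Omega> q) = (\<Sum>h\<in>H (s q). \<Prod>p\<in>S. 1 + excess \<Omega> k h p) / s q ^ (k - 1)"
      using correlation_crt_set[OF q(1), of k ?Q] k q(2) dilate_lattice_points_box[of "s q" k a w]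
      by (simp add: S_def H_def s[unfolded S_def, symmetric])
    moreover have "\<bar>x / s q ^ (k - 1) - y / s q ^ (k - 1)\<bar> = \<bar>x - y\<bar> / s q ^ (k - 1)" for x y
      using q(2) by (simp add: abs_divide flip: diff_divide_distrib)
    ultimately show ?thesis by simp
  qed
  have "(c \<longlongrightarrow> 2 * real (k - 1) * (2 * B) ^ (k - 2) * 0 + M * (2 * B) ^ (k - 1) * 0) at_top"
    unfolding c_def using eta by (intro tendsto_intros tendsto_neg_powr filterlim_ident) auto
  then have c0: "(c \<longlongrightarrow> 0) at_top" by simp
  have lim: "filterlim s at_top (spacing_at_top \<Omega>)"
    unfolding s_def by (rule filterlim_spacing_at_top)
  have "((\<lambda>q. correlation k ?Q q (crt_set \<Omega> q) - real (card (H (s q))) / s q ^ (k - 1)) \<longlongrightarrow> 0) (spacing_at_top \<Omega>)"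
  proof (rule Lim_null_comparison[OF _ filterlim_compose[OF c0 lim]])
    show "eventually (\<lambda>q. norm (correlation k ?Q q (crt_set \<Omega> q) - real (card (H (s q))) / s q ^ (k - 1)) \<le> c (s q))
        (spacing_at_top \<Omega>)"
      using eventually_spacing_at_top[of 1 \<Omega>] by (rule eventually_mono) (use bound in \<open>auto simp: s_def\<close>)
  qed
  moreover have "((\<lambda>q. real (card (H (s q))) / s q ^ (k - 1)) \<longlongrightarrow> w ^ (k - 1)) (spacing_at_top \<Omega>)"
    unfolding H_def by (rule filterlim_compose[OF tendsto_card_dilated_box[OF \<open>0 < w\<close>] lim])
  ultimately show ?thesis
    using tendsto_add by fastforce
qed

end

section \<open>Approximation by cubes\<close>

text \<open>The half-open cells of the grid of mesh \<open>1 / N\<close>, which tile the space: each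
  point lies in exactly one, found by rounding down.\<close>

definition cube :: "nat \<Rightarrow> nat \<Rightarrow> (nat \<Rightarrow> int) \<Rightarrow> (nat \<Rightarrow> real) set" where
  "cube k N z = PiE {1..<k} (\<lambda>i. {real_of_int (z i) / real N..<real_of_int (z i) / real N + 1 / real N})"

definition cube_index :: "nat \<Rightarrow> nat \<Rightarrow> (nat \<Rightarrow> real) \<Rightarrow> nat \<Rightarrow> int" where
  "cube_index k N x = (\<lambda>i\<in>{1..<k}. \<lfloor>real N * x i\<rfloor>)"

lemma mem_cube_iff:
  assumes "0 < N" "z \<in> {1..<k} \<rightarrow>\<^sub>E UNIV"
  shows "x \<in> cube k N z \<longleftrightarrow> x \<in> {1..<k} \<rightarrow>\<^sub>E UNIV \<and> cube_index k N x = z"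
proof -
  have "real_of_int (z i) / real N \<le> x i \<and> x i < real_of_int (z i) / real N + 1 / real N
      \<longleftrightarrow> \<lfloor>real N * x i\<rfloor> = z i" for i
    using assms(1) by (auto simp: floor_eq_iff field_simps)
  then show ?thesis
    using assms(2) by (auto simp: cube_def cube_index_def PiE_iff extensional_def fun_eq_iff)
qed

lemma cube_index_in_PiE: "cube_index k N x \<in> {1..<k} \<rightarrow>\<^sub>E UNIV"
  by (simp add: cube_index_def)

lemma dist_lt_of_cube_index_eq:
  assumes "0 < N" "cube_index k N x = cube_index k N y" "i \<in> {1..<k}"
  shows "\<bar>x i - y i\<bar> < 1 / real N"
proof -
  have "\<lfloor>real N * x i\<rfloor> = \<lfloor>real N * y i\<rfloor>"
    using fun_cong[OF assms(2), of i] assms(3) by (simp add: cube_index_def)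
  then have "\<bar>real N * x i - real N * y i\<bar> < 1"
    using floor_correct[of "real N * x i"] floor_correct[of "real N * y i"] by linarith
  then have "real N * \<bar>x i - y i\<bar> < 1" by (simp add: abs_mult flip: right_diff_distrib)
  then show ?thesis using assms(1) by (simp add: field_simps)
qed

lemma cubes_Union_iff:
  assumes "0 < N" "Z \<subseteq> {1..<k} \<rightarrow>\<^sub>E UNIV"
  shows "x \<in> (\<Union>z\<in>Z. cube k N z) \<longleftrightarrow> x \<in> {1..<k} \<rightarrow>\<^sub>E UNIV \<and> cube_index k N x \<in> Z"
  using mem_cube_iff[OF assms(1)] assms(2) by (auto simp: subset_iff)

lemma disjoint_cubes:
  assumes "0 < N" "Z \<subseteq> {1..<k} \<rightarrow>\<^sub>E UNIV"
  shows "disjoint_family_on (cube k N) Z"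
  unfolding disjoint_family_on_def
proof (intro ballI impI)
  fix z z' assume "z \<in> Z" "z' \<in> Z" "z \<noteq> z'"
  then have "z \<in> {1..<k} \<rightarrow>\<^sub>E UNIV" "z' \<in> {1..<k} \<rightarrow>\<^sub>E UNIV" using assms(2) by blast+
  from this[THEN mem_cube_iff[OF assms(1)]] \<open>z \<noteq> z'\<close>
  show "cube k N z \<inter> cube k N z' = {}" by (auto simp: disjoint_iff)
qed

lemma sets_cube: "cube k N z \<in> sets (vol_measure k)"
  unfolding cube_def vol_measure_def by (intro sets_PiM_I_finite) auto

lemma space_vol_measure: "space (vol_measure k) = {1..<k} \<rightarrow>\<^sub>E UNIV"
  by (simp add: vol_measure_def space_PiM)

lemma emeasure_vol_box:
  assumes "\<And>i. i \<in> {1..<k} \<Longrightarrow> A i \<in> sets lborel"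
  shows "emeasure (vol_measure k) (PiE {1..<k} A) = (\<Prod>i\<in>{1..<k}. emeasure lborel (A i))"
proof -
  interpret product_sigma_finite "\<lambda>_::nat. lborel :: real measure" ..
  show ?thesis unfolding vol_measure_def using assms by (intro emeasure_PiM) auto
qed

lemma measure_cubes:
  assumes "0 < N" "finite Z" "Z \<subseteq> {1..<k} \<rightarrow>\<^sub>E UNIV"
  shows "measure (vol_measure k) (\<Union>z\<in>Z. cube k N z) = real (card Z) * (1 / real N) ^ (k - 1)"
proof -
  have cube: "emeasure (vol_measure k) (cube k N z) = ennreal ((1 / real N) ^ (k - 1))" for z
  proof -
    have "emeasure (vol_measure k) (cube k N z) = (\<Prod>i\<in>{1..<k}. ennreal (1 / real N))"
      unfolding cube_def by (subst emeasure_vol_box) auto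
    then show ?thesis by (simp add: ennreal_power)
  qed
  have "measure (vol_measure k) (\<Union>z\<in>Z. cube k N z) = (\<Sum>z\<in>Z. measure (vol_measure k) (cube k N z))"
    using assms by (intro measure_finite_Union disjoint_cubes) (auto simp: sets_cube cube)
  also have "\<dots> = (\<Sum>z\<in>Z. (1 / real N) ^ (k - 1))"
    by (intro sum.cong refl) (simp add: measure_def cube)
  finally show ?thesis by simp
qed

text \<open>A basic open set of a finite product contains a ball for the maximum norm, with the
  least of the coordinate radii.\<close>

lemma openin_real_space_nhd:
  assumes "openin (real_space k) U" "x \<in> U"
  shows "\<exists>e>0. \<forall>y\<in>{1..<k} \<rightarrow>\<^sub>E UNIV. (\<forall>i\<in>{1..<k}. \<bar>y i - x i\<bar> < e) \<longrightarrow> y \<in> U"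
proof -
  obtain V where V: "\<forall>i\<in>{1..<k}. open (V i)" "x \<in> PiE {1..<k} V" "PiE {1..<k} V \<subseteq> U"
    using assms unfolding real_space_def openin_product_topology_alt by auto
  have "\<forall>i\<in>{1..<k}. \<exists>e>0. \<forall>t. \<bar>t - x i\<bar> < e \<longrightarrow> t \<in> V i"
  proof
    fix i assume i: "i \<in> {1..<k}"
    then have "x i \<in> V i" using V(2) by (rule PiE_mem[rotated])
    with V(1) i obtain e where "0 < e" "\<forall>t. dist t (x i) < e \<longrightarrow> t \<in> V i"
      unfolding open_dist by blast
    then show "\<exists>e>0. \<forall>t. \<bar>t - x i\<bar> < e \<longrightarrow> t \<in> V i" by (auto simp: dist_real_def)
  qed
  then obtain e where e: "\<And>i. i \<in> {1..<k} \<Longrightarrow> 0 < e i \<and> (\<forall>t. \<bar>t - x i\<bar> < e i \<longrightarrow> t \<in> V i)"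
    by metis
  \<comment> \<open>The inserted \<open>1\<close> keeps the minimum meaningful when there are no
    coordinates.\<close>
  define d where "d = Min (insert 1 (e ` {1..<k}))"
  have "0 < d" unfolding d_def using e by (subst Min_gr_iff) auto
  moreover have "y \<in> U" if y: "y \<in> {1..<k} \<rightarrow>\<^sub>E UNIV" "\<forall>i\<in>{1..<k}. \<bar>y i - x i\<bar> < d" for y
  proof -
    have "y i \<in> V i" if "i \<in> {1..<k}" for i
    proof -
      have "d \<le> e i" unfolding d_def using that by (intro Min_le) auto
      then have "\<bar>y i - x i\<bar> < e i" using y(2) that by force
      then show ?thesis using e[OF that] by blast
    qed
    then have "y \<in> PiE {1..<k} V" using y(1) by (simp add: PiE_iff)
    then show ?thesis using V(3) by blast
  qed
  ultimately show ?thesis by blast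
qed

lemma eventually_inverse_Suc_less:
  "0 < e \<Longrightarrow> eventually (\<lambda>n. 1 / real (Suc n) < e) sequentially"
  using order_tendstoD(2)[OF LIMSEQ_inverse_real_of_nat] by (simp add: inverse_eq_divide)

text \<open>Some ball around \<open>x\<close> misses \<open>X\<close>; once the mesh is below its
  radius, no point of \<open>X\<close> shares the cube of \<open>x\<close>.\<close>

lemma closedin_eventually_not_cube_index:
  assumes "closedin (real_space k) X" "x \<in> {1..<k} \<rightarrow>\<^sub>E UNIV" "x \<notin> X"
  shows "eventually (\<lambda>n. cube_index k (Suc n) x \<notin> cube_index k (Suc n) ` X) sequentially"
proof -
  have top: "topspace (real_space k) = {1..<k} \<rightarrow>\<^sub>E UNIV" by (simp add: real_space_def)
  have "openin (real_space k) (topspace (real_space k) - X)" using assms(1) by blast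
  from openin_real_space_nhd[OF this, of x] assms(2,3) obtain e where e: "0 < e"
    "\<And>y. y \<in> {1..<k} \<rightarrow>\<^sub>E UNIV \<Longrightarrow> (\<forall>i\<in>{1..<k}. \<bar>y i - x i\<bar> < e) \<Longrightarrow> y \<notin> X"
    unfolding top by blast
  have X: "X \<subseteq> {1..<k} \<rightarrow>\<^sub>E UNIV" using closedin_subset[OF assms(1)] top by simp
  show ?thesis
    using eventually_inverse_Suc_less[OF e(1)]
  proof eventually_elim
    case (elim n)
    show ?case
    proof
      assume "cube_index k (Suc n) x \<in> cube_index k (Suc n) ` X"
      then obtain y where y: "y \<in> X" "cube_index k (Suc n) y = cube_index k (Suc n) x" by auto
      then have "\<bar>y i - x i\<bar> < e" if "i \<in> {1..<k}" for i
        using dist_lt_of_cube_index_eq[OF _ y(2) that] elim by simp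
      with e(2)[of y] X y(1) show False by blast
    qed
  qed
qed

text \<open>A closed set is the intersection, over all meshes, of the countable unions of the cubes
  meeting it.\<close>

lemma closedin_real_space_measurable:
  assumes "closedin (real_space k) X"
  shows "X \<in> sets (vol_measure k)"
proof -
  have X: "X \<subseteq> {1..<k} \<rightarrow>\<^sub>E UNIV"
    using closedin_subset[OF assms] by (simp add: real_space_def)
  define T where "T n = (\<Union>z\<in>cube_index k (Suc n) ` X. cube k (Suc n) z)" for n
  have T: "x \<in> T n \<longleftrightarrow> x \<in> {1..<k} \<rightarrow>\<^sub>E UNIV \<and> cube_index k (Suc n) x \<in> cube_index k (Suc n) ` X" for x n
    unfolding T_def using cube_index_in_PiE by (intro cubes_Union_iff) blast+
  have XT: "X = (\<Inter>n. T n)"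
  proof (intro equalityI subsetI)
    fix x assume x: "x \<in> (\<Inter>n. T n)"
    then have "x \<in> {1..<k} \<rightarrow>\<^sub>E UNIV" using T by blast
    moreover have "\<not> eventually (\<lambda>n. cube_index k (Suc n) x \<notin> cube_index k (Suc n) ` X) sequentially"
      using x T by auto
    ultimately show "x \<in> X" using closedin_eventually_not_cube_index[OF assms] by blast
  qed (use X T in blast)
  have "T n \<in> sets (vol_measure k)" for n
  proof -
    have "countable ({1..<k} \<rightarrow>\<^sub>E (UNIV :: int set))" by (intro countable_PiE) auto
    then have "countable (cube_index k (Suc n) ` X)"
      by (rule countable_subset[rotated]) (use cube_index_in_PiE in blast)
    then show ?thesis unfolding T_def by (intro sets.countable_UN') (auto simp: sets_cube)
  qed
  then show ?thesis by (subst XT) (intro sets.countable_INT', auto)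
qed

section \<open>Compact sets in the ordered cone\<close>

lemma compactin_real_space_image:
  assumes "compactin (real_space k) X" "i < k" "j < k"
  shows "compact ((\<lambda>x. (x(0 := 0)) j - (x(0 := 0)) i) ` X)"
proof -
  have proj: "continuous_map (real_space k) euclideanreal (\<lambda>x. (x(0 := 0)) i)" if "i < k" for i
  proof (cases "i = 0")
    case False
    then show ?thesis
      using continuous_map_product_projection[of i "{1..<k}" "\<lambda>_. euclideanreal"] that
      by (simp add: real_space_def)
  qed simp
  have "continuous_map (real_space k) euclideanreal (\<lambda>x. (x(0 := 0)) j - (x(0 := 0)) i)"
    using assms by (intro continuous_map_diff proj)
  from image_compactin[OF assms(1) this] show ?thesis by simp
qed

text \<open>Each coordinate difference is continuous and positive on \<open>X\<close>, hence has a
  positive minimum; there are finitely many pairs, those with index \<open>0\<close>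
  included.\<close>

lemma compact_cone_gap:
  assumes "compactin (real_space k) X" "X \<subseteq> ordered_cone k"
  shows "\<exists>\<delta>>0. \<forall>x\<in>X. \<forall>i j. i < j \<longrightarrow> j < k \<longrightarrow> \<delta> \<le> (x(0 := 0)) j - (x(0 := 0)) i"
proof -
  define P where "P = {ij \<in> {..<k} \<times> {..<k}. fst ij < snd ij}"
  have gap: "\<exists>\<delta>>0. \<forall>x\<in>X. \<delta> \<le> (x(0 := 0)) (snd ij) - (x(0 := 0)) (fst ij)" if mem: "ij \<in> P" for ij
  proof (cases "X = {}")
    case False
    obtain i j where ij: "ij = (i, j)" "i < j" "j < k" using mem by (cases ij) (auto simp: P_def)
    let ?f = "\<lambda>x. (x(0 := 0)) j - (x(0 := 0)) i"
    have "compact (?f ` X)" using ij assms(1) by (intro compactin_real_space_image) auto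
    then obtain y where y: "y \<in> X" "\<forall>x\<in>X. ?f y \<le> ?f x"
      using compact_attains_inf[of "?f ` X"] False by auto
    have "strict_mono_on {..<k} (y(0 := 0))" using y(1) assms(2) by (auto simp: ordered_cone_def)
    then have "0 < ?f y" using ij by (auto simp: strict_mono_on_def)
    with y(2) show ?thesis unfolding ij(1) fst_conv snd_conv by blast
  qed (auto intro: exI[of _ 1])
  have "\<exists>\<delta>. \<forall>ij\<in>P. 0 < \<delta> ij \<and> (\<forall>x\<in>X. \<delta> ij \<le> (x(0 := 0)) (snd ij) - (x(0 := 0)) (fst ij))"
    by (rule bchoice) (use gap in blast)
  then obtain \<delta> where \<delta>: "\<And>ij. ij \<in> P \<Longrightarrow>
      0 < \<delta> ij \<and> (\<forall>x\<in>X. \<delta> ij \<le> (x(0 := 0)) (snd ij) - (x(0 := 0)) (fst ij))"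
    by blast
  define d where "d = Min (insert 1 (\<delta> ` P))"
  have fin: "finite (insert 1 (\<delta> ` P))" by (simp add: P_def)
  have "0 < d" unfolding d_def using fin \<delta> by (subst Min_gr_iff) auto
  moreover have "d \<le> (x(0 := 0)) j - (x(0 := 0)) i" if "x \<in> X" "i < j" "j < k" for x i j
  proof -
    have ij: "(i, j) \<in> P" using that by (auto simp: P_def)
    then have "d \<le> \<delta> (i, j)" unfolding d_def using fin by (intro Min_le) auto
    then show ?thesis using \<delta>[OF ij] that(1) by force
  qed
  ultimately show ?thesis by blast
qed

lemma compact_real_space_bounded:
  assumes "compactin (real_space k) X"
  shows "\<exists>B\<ge>0. \<forall>x\<in>X. \<forall>i\<in>{1..<k}. \<bar>x i\<bar> \<le> B"
proof -
  have "\<exists>B\<ge>0. \<forall>x\<in>X. \<bar>x i\<bar> \<le> B" if "i \<in> {1..<k}" for i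
  proof -
    have "compact ((\<lambda>x. x i) ` X)"
      using compactin_real_space_image[OF assms, of 0 i] that by (cases "i = 0") auto
    then have "bounded ((\<lambda>x. x i) ` X)" by (rule compact_imp_bounded)
    then obtain B where "\<forall>x\<in>X. \<bar>x i\<bar> \<le> B" unfolding bounded_iff by auto
    then show ?thesis by (intro exI[of _ "max 0 B"]) (auto simp: le_max_iff_disj)
  qed
  then obtain B where B: "\<And>i. i \<in> {1..<k} \<Longrightarrow> 0 \<le> B i \<and> (\<forall>x\<in>X. \<bar>x i\<bar> \<le> B i)" by metis
  show ?thesis
  proof (intro exI[of _ "sum B {1..<k}"] conjI ballI)
    show "0 \<le> sum B {1..<k}" using B by (intro sum_nonneg) auto
    fix x i assume "x \<in> X" "i \<in> {1..<k}"
    then have "\<bar>x i\<bar> \<le> B i" using B by blast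
    also have "\<dots> \<le> sum B {1..<k}" using B \<open>i \<in> {1..<k}\<close> by (intro member_le_sum) auto
    finally show "\<bar>x i\<bar> \<le> sum B {1..<k}" .
  qed
qed

lemma compactin_real_space_closedin:
  assumes "compactin (real_space k) X"
  shows "closedin (real_space k) X"
  using assms unfolding real_space_def
  by (intro compactin_imp_closedin) (auto simp: Hausdorff_space_product_topology)

text \<open>
  Outer approximations work for every compact set; only the inner ones need the null frontier.
\<close>

lemma cube_approximation:
  assumes X: "compactin (real_space k) X" and null: "jordan_null_frontier k X"
  defines "out \<equiv> \<lambda>n. cube_index k (Suc n) ` X"
  defines "inn \<equiv> \<lambda>n. {z \<in> {1..<k} \<rightarrow>\<^sub>E UNIV. cube k (Suc n) z \<subseteq> X}"
  shows "finite (out n)" "inn n \<subseteq> out n"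
    "(\<lambda>n. measure (vol_measure k) (\<Union>z\<in>out n. cube k (Suc n) z)) \<longlonglongrightarrow> measure (vol_measure k) X"
    "(\<lambda>n. measure (vol_measure k) (\<Union>z\<in>inn n. cube k (Suc n) z)) \<longlonglongrightarrow> measure (vol_measure k) X"
proof -
  let ?\<mu> = "vol_measure k"
  let ?E = "{1..<k} \<rightarrow>\<^sub>E (UNIV :: real set)"
  have top: "topspace (real_space k) = ?E" by (simp add: real_space_def)
  have closed: "closedin (real_space k) X" using X by (rule compactin_real_space_closedin)
  have XE: "X \<subseteq> ?E" using closedin_subset[OF closed] top by simp
  obtain B where B: "0 \<le> B" "\<And>x i. x \<in> X \<Longrightarrow> i \<in> {1..<k} \<Longrightarrow> \<bar>x i\<bar> \<le> B"
    using compact_real_space_bounded[OF X] by blast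
  define U where "U n Z = (\<Union>z\<in>Z. cube k (Suc n) z)" for n Z
  \<comment> \<open>A fixed region of finite volume that contains every cube meeting
    \<open>X\<close>, since cubes have side at most \<open>1\<close>.\<close>
  define box where "box = PiE {1..<k} (\<lambda>_. {- B - 1..B + 1})"
  have in_E: "out n \<subseteq> {1..<k} \<rightarrow>\<^sub>E UNIV" "inn n \<subseteq> {1..<k} \<rightarrow>\<^sub>E UNIV" for n
    unfolding out_def inn_def using cube_index_in_PiE by blast+
  have U: "x \<in> U n Z \<longleftrightarrow> x \<in> ?E \<and> cube_index k (Suc n) x \<in> Z" if "Z \<subseteq> {1..<k} \<rightarrow>\<^sub>E UNIV" for x n Z
    unfolding U_def using that by (intro cubes_Union_iff) auto
  have fin: "finite (out n)" for n
  proof (rule finite_subset)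
    show "out n \<subseteq> PiE {1..<k} (\<lambda>_. {\<lfloor>- (real (Suc n) * B)\<rfloor>..\<lfloor>real (Suc n) * B\<rfloor>})"
    proof
      fix z assume "z \<in> out n"
      then obtain x where x: "x \<in> X" "z = cube_index k (Suc n) x" by (auto simp: out_def)
      have "\<lfloor>- (real (Suc n) * B)\<rfloor> \<le> \<lfloor>real (Suc n) * x i\<rfloor> \<and> \<lfloor>real (Suc n) * x i\<rfloor> \<le> \<lfloor>real (Suc n) * B\<rfloor>"
        if "i \<in> {1..<k}" for i
      proof -
        have "- B \<le> x i" "x i \<le> B" using B(2)[OF x(1) that] by auto
        from this[THEN mult_left_mono[OF _ of_nat_0_le_iff[of "Suc n"]]]
        show ?thesis by (intro conjI floor_mono) auto
      qed
      then show "z \<in> PiE {1..<k} (\<lambda>_. {\<lfloor>- (real (Suc n) * B)\<rfloor>..\<lfloor>real (Suc n) * B\<rfloor>})"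
        unfolding x(2) cube_index_def by (auto simp del: of_nat_Suc)
    qed
  qed (intro finite_PiE, auto)
  then show "finite (out n)" .
  have index_in_out: "cube_index k (Suc n) x \<in> out n" if "x \<in> X" for x n
    using that by (simp add: out_def)
  have inn_sub: "inn n \<subseteq> out n" for n
  proof
    fix z assume z: "z \<in> inn n"
    \<comment> \<open>The lower corner belongs to its cube, hence to \<open>X\<close>, and has index
      \<open>z\<close>.\<close>
    define x where "x = (\<lambda>i\<in>{1..<k}. real_of_int (z i) / real (Suc n))"
    have "x \<in> cube k (Suc n) z" by (auto simp: x_def cube_def)
    moreover from this have "cube_index k (Suc n) x = z" using mem_cube_iff[of "Suc n" z k x] z by (auto simp: inn_def)
    ultimately show "z \<in> out n" using z by (auto simp: out_def inn_def)
  qed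
  then show "inn n \<subseteq> out n" .
  have sets_U: "U n Z \<in> sets ?\<mu>" if "finite Z" for n Z
    unfolding U_def using that sets_cube by (intro sets.finite_UN) auto
  have sets_X: "X \<in> sets ?\<mu>" using closed by (rule closedin_real_space_measurable)
  have box: "box \<in> sets ?\<mu>" "emeasure ?\<mu> box < \<infinity>"
  proof -
    show "box \<in> sets ?\<mu>" unfolding box_def vol_measure_def by (intro sets_PiM_I_finite) auto
    have "emeasure ?\<mu> box = (\<Prod>i\<in>{1..<k}. ennreal (2 * B + 2))"
      unfolding box_def using B(1) by (subst emeasure_vol_box) auto
    then show "emeasure ?\<mu> box < \<infinity>" by (simp add: ennreal_power power_less_top_ennreal)
  qed
  have U_box: "U n Z \<subseteq> box" if "Z \<subseteq> out n" for n Z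
  proof
    fix x assume "x \<in> U n Z"
    then have x: "x \<in> ?E" "cube_index k (Suc n) x \<in> out n" using U[of Z] that in_E(1)[of n] by blast+
    then obtain y where y: "y \<in> X" "cube_index k (Suc n) x = cube_index k (Suc n) y" by (auto simp: out_def)
    have "\<bar>x i\<bar> \<le> B + 1" if "i \<in> {1..<k}" for i
    proof -
      have "\<bar>x i - y i\<bar> < 1 / real (Suc n)" by (rule dist_lt_of_cube_index_eq[OF _ y(2) that]) simp
      also have "\<dots> \<le> 1" by simp
      finally show ?thesis using B(2)[OF y(1) that] by linarith
    qed
    then show "x \<in> box" using x(1) by (force simp: box_def PiE_iff abs_le_iff)
  qed
  \<comment> \<open>Dominated convergence of indicator functions: with \<open>box\<close> as
    majorant, eventual agreement almost everywhere suffices.\<close>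
  have limit: "(\<lambda>n. measure ?\<mu> (U n (Z n))) \<longlonglongrightarrow> measure ?\<mu> X"
    if Z: "\<And>n. Z n \<subseteq> out n"
      and ae: "AE x in ?\<mu>. eventually (\<lambda>n. x \<in> U n (Z n) \<longleftrightarrow> x \<in> X) sequentially" for Z
  proof -
    have finZ: "finite (Z n)" for n using Z fin finite_subset by blast
    have "(\<lambda>n. integral\<^sup>L ?\<mu> (indicat_real (U n (Z n)))) \<longlonglongrightarrow> integral\<^sup>L ?\<mu> (indicat_real X)"
    proof (rule integral_dominated_convergence[where w = "indicat_real box"])
      show "AE x in ?\<mu>. (\<lambda>n. indicat_real (U n (Z n)) x) \<longlonglongrightarrow> indicat_real X x"
        using ae
      proof eventually_elim
        case (elim x)
        then have "eventually (\<lambda>n. indicat_real (U n (Z n)) x = indicat_real X x) sequentially"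
          by eventually_elim (auto simp: indicator_def)
        then show ?case by (rule tendsto_eventually)
      qed
      show "AE x in ?\<mu>. norm (indicat_real (U n (Z n)) x) \<le> indicat_real box x" for n
        using U_box[OF Z] by (intro AE_I2) (auto simp: indicator_def)
    qed (use sets_U[OF finZ] sets_X box in auto)
    moreover have "A \<inter> space ?\<mu> = A" if "A \<in> sets ?\<mu>" for A
      using sets.sets_into_space[OF that] by blast
    ultimately show ?thesis using sets_U[OF finZ] sets_X by simp
  qed
  have outside: "eventually (\<lambda>n. cube_index k (Suc n) x \<notin> out n) sequentially" if "x \<in> ?E" "x \<notin> X" for x
    unfolding out_def by (rule closedin_eventually_not_cube_index[OF closed that])
  show "(\<lambda>n. measure ?\<mu> (\<Union>z\<in>out n. cube k (Suc n) z)) \<longlonglongrightarrow> measure ?\<mu> X"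
    unfolding U_def[symmetric]
  proof (rule limit)
    show "AE x in ?\<mu>. eventually (\<lambda>n. x \<in> U n (out n) \<longleftrightarrow> x \<in> X) sequentially"
    proof (rule AE_I2)
      fix x assume "x \<in> space ?\<mu>"
      then have x: "x \<in> ?E" by (simp add: space_vol_measure)
      show "eventually (\<lambda>n. x \<in> U n (out n) \<longleftrightarrow> x \<in> X) sequentially"
      proof (cases "x \<in> X")
        case True
        then show ?thesis using x index_in_out U[OF in_E(1)] by simp
      next
        case False
        from outside[OF x False] show ?thesis
          by eventually_elim (use False U[OF in_E(1)] in simp)
      qed
    qed
  qed simp
  let ?F = "real_space k frontier_of X"
  have F: "?F \<in> null_sets ?\<mu>"
    using null closedin_real_space_measurable[OF closedin_frontier_of]
    by (auto simp: jordan_null_frontier_def)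
  show "(\<lambda>n. measure ?\<mu> (\<Union>z\<in>inn n. cube k (Suc n) z)) \<longlonglongrightarrow> measure ?\<mu> X"
    unfolding U_def[symmetric]
  proof (rule limit)
    show "AE x in ?\<mu>. eventually (\<lambda>n. x \<in> U n (inn n) \<longleftrightarrow> x \<in> X) sequentially"
      using AE_not_in[OF F] AE_space
    proof eventually_elim
      case (elim x)
      then have x: "x \<in> ?E" by (simp add: space_vol_measure)
      show ?case
      proof (cases "x \<in> X")
        case True
        \<comment> \<open>Off the frontier a point of the closure is interior, so for small mesh its
          whole cube lies in \<open>X\<close>.\<close>
        then have "x \<in> real_space k closure_of X"
          using closure_of_subset[of X "real_space k"] XE top by auto
        then have "x \<in> real_space k interior_of X" using elim by (auto simp: frontier_of_def)
        from openin_real_space_nhd[OF openin_interior_of this] obtain e where e: "0 < e"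
          "\<forall>y\<in>?E. (\<forall>i\<in>{1..<k}. \<bar>y i - x i\<bar> < e) \<longrightarrow> y \<in> real_space k interior_of X"
          by auto
        show ?thesis
          using eventually_inverse_Suc_less[OF e(1)]
        proof eventually_elim
          case (elim n)
          have "cube k (Suc n) (cube_index k (Suc n) x) \<subseteq> X"
          proof
            fix y assume "y \<in> cube k (Suc n) (cube_index k (Suc n) x)"
            then have y: "y \<in> ?E" "cube_index k (Suc n) y = cube_index k (Suc n) x"
              using mem_cube_iff[OF _ cube_index_in_PiE, of "Suc n"] by auto
            have "\<bar>y i - x i\<bar> < e" if "i \<in> {1..<k}" for i
              using dist_lt_of_cube_index_eq[OF _ y(2) that] elim by simp
            then have "y \<in> real_space k interior_of X" using e(2) y(1) by auto
            then show "y \<in> X" by (rule subsetD[OF interior_of_subset])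
          qed
          then have "cube_index k (Suc n) x \<in> inn n" using cube_index_in_PiE by (simp add: inn_def)
          then show ?case using True x U[OF in_E(2)] by simp
        qed
      next
        case False
        have "x \<notin> U n (inn n)" for n using False by (auto simp: U_def inn_def)
        then show ?thesis using False by simp
      qed
    qed
  qed (rule inn_sub)
qed

text \<open>A point in a cube meeting \<open>X\<close> is within the mesh of a point of
  \<open>X\<close>, whose coordinate gaps are bounded below.\<close>

lemma compact_cone_cubes:
  assumes "compactin (real_space k) X" "X \<subseteq> ordered_cone k"
  shows "eventually (\<lambda>n. \<forall>z\<in>cube_index k (Suc n) ` X. cube k (Suc n) z \<subseteq> ordered_cone k) sequentially"
proof -
  obtain \<delta> where \<delta>: "0 < \<delta>" "\<And>x i j. x \<in> X \<Longrightarrow> i < j \<Longrightarrow> j < k \<Longrightarrow> \<delta> \<le> (x(0 := 0)) j - (x(0 := 0)) i"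
    using compact_cone_gap[OF assms] by blast
  \<comment> \<open>Two coordinates move, each by less than \<open>\<delta> / 2\<close>, so a gap of
    \<open>\<delta>\<close> stays positive.\<close>
  have "0 < \<delta> / 2" using \<delta>(1) by simp
  from eventually_inverse_Suc_less[OF this] show ?thesis
  proof eventually_elim
    case (elim n)
    show ?case
    proof (intro ballI subsetI)
      fix z y assume "z \<in> cube_index k (Suc n) ` X" "y \<in> cube k (Suc n) z"
      then obtain x where x: "x \<in> X" and y: "y \<in> {1..<k} \<rightarrow>\<^sub>E UNIV" "cube_index k (Suc n) y = cube_index k (Suc n) x"
        using mem_cube_iff[OF _ cube_index_in_PiE, of "Suc n"] by auto
      have near: "\<bar>(y(0 := 0)) i - (x(0 := 0)) i\<bar> < \<delta> / 2" if "i < k" for i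
      proof (cases "i = 0")
        case False
        then show ?thesis using dist_lt_of_cube_index_eq[OF _ y(2), of i] that elim by auto
      qed (use \<delta>(1) in simp)
      have "strict_mono_on {..<k} (y(0 := 0))"
      proof (rule strict_mono_onI)
        fix i j assume "i \<in> {..<k}" "j \<in> {..<k}" "i < j"
        then have "\<bar>(y(0 := 0)) i - (x(0 := 0)) i\<bar> < \<delta> / 2" "\<bar>(y(0 := 0)) j - (x(0 := 0)) j\<bar> < \<delta> / 2"
          "\<delta> \<le> (x(0 := 0)) j - (x(0 := 0)) i"
          by (intro near \<delta>(2) x; simp)+
        then show "(y(0 := 0)) i < (y(0 := 0)) j" by linarith
      qed
      then show "y \<in> ordered_cone k" using y(1) by (simp add: ordered_cone_def)
    qed
  qed
qed

section \<open>Monotonicity and additivity of the correlation\<close>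

lemma dilate_lattice_points_Union:
  "dilate_lattice_points k s (\<Union>z\<in>Z. Q z) = (\<Union>z\<in>Z. dilate_lattice_points k s (Q z))"
  unfolding dilate_lattice_points_def by blast

lemma dilate_lattice_points_mono:
  "X \<subseteq> Y \<Longrightarrow> dilate_lattice_points k s X \<subseteq> dilate_lattice_points k s Y"
  unfolding dilate_lattice_points_def by blast

lemma finite_dilate_cube: "0 < s \<Longrightarrow> finite (dilate_lattice_points k s (cube k N z))"
  unfolding cube_def by (subst dilate_lattice_points_box) (auto intro!: finite_PiE)

text \<open>Finiteness matters because a sum over an infinite set is \<open>0\<close> by default;
  the summands are nonnegative.\<close>

lemma correlation_mono:
  assumes "X \<subseteq> Y" "finite (dilate_lattice_points k (spacing q A) Y)"
  shows "correlation k X q A \<le> correlation k Y q A"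
  unfolding correlation_def using assms dilate_lattice_points_mono[OF assms(1)]
  by (intro mult_left_mono sum_mono2) auto

text \<open>For positive spacing \<open>s\<close> a lattice point \<open>h\<close> determines the
  point \<open>h / s\<close>, so disjoint cubes have disjoint sets of lattice points.\<close>

lemma correlation_cubes:
  assumes "0 < N" "finite Z" "Z \<subseteq> {1..<k} \<rightarrow>\<^sub>E UNIV" "0 < spacing q A"
  shows "correlation k (\<Union>z\<in>Z. cube k N z) q A = (\<Sum>z\<in>Z. correlation k (cube k N z) q A)"
proof -
  let ?D = "\<lambda>z. dilate_lattice_points k (spacing q A) (cube k N z)"
  have "z = z'" if zz: "z \<in> Z" "z' \<in> Z" "h \<in> ?D z" "h \<in> ?D z'" for h z z'
  proof -
    obtain x y where x: "x \<in> cube k N z" "\<And>i. i \<in> {1..<k} \<Longrightarrow> real_of_int (h i) = spacing q A * x i"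
      and y: "y \<in> cube k N z'" "\<And>i. i \<in> {1..<k} \<Longrightarrow> real_of_int (h i) = spacing q A * y i"
      using zz(3,4) unfolding dilate_lattice_points_def by blast
    have "x = y"
    proof (rule extensionalityI[of _ "{1..<k}"])
      show "x \<in> extensional {1..<k}" "y \<in> extensional {1..<k}"
        using x(1) y(1) by (simp_all add: cube_def PiE_iff)
      fix i assume "i \<in> {1..<k}"
      then have "spacing q A * x i = spacing q A * y i" using x(2)[of i] y(2)[of i] by linarith
      then show "x i = y i" using assms(4) by simp
    qed
    moreover have "cube_index k N x = z" "cube_index k N y = z'"
      using x(1) y(1) mem_cube_iff[OF assms(1) subsetD[OF assms(3) zz(1)]]
        mem_cube_iff[OF assms(1) subsetD[OF assms(3) zz(2)]] by auto
    ultimately show ?thesis by simp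
  qed
  then have "(\<Sum>h\<in>(\<Union>z\<in>Z. ?D z). real (shift_count k h q A)) = (\<Sum>z\<in>Z. \<Sum>h\<in>?D z. real (shift_count k h q A))"
    using assms finite_dilate_cube by (intro sum.UNION_disjoint) blast+
  then show ?thesis by (simp add: correlation_def dilate_lattice_points_Union sum_distrib_left)
qed

context poisson_family
begin

lemma correlation_cubes_tendsto:
  assumes "0 < N" "finite Z" "Z \<subseteq> {1..<k} \<rightarrow>\<^sub>E UNIV" "\<forall>z\<in>Z. cube k N z \<subseteq> ordered_cone k"
  shows "((\<lambda>q. correlation k (\<Union>z\<in>Z. cube k N z) q (crt_set \<Omega> q)) \<longlongrightarrow>
           measure (vol_measure k) (\<Union>z\<in>Z. cube k N z)) (spacing_at_top \<Omega>)"
proof -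
  have "((\<lambda>q. \<Sum>z\<in>Z. correlation k (cube k N z) q (crt_set \<Omega> q)) \<longlongrightarrow> (\<Sum>z\<in>Z. (1 / real N) ^ (k - 1)))
      (spacing_at_top \<Omega>)"
    using assms unfolding cube_def by (intro tendsto_sum correlation_box_tendsto) auto
  then have "((\<lambda>q. \<Sum>z\<in>Z. correlation k (cube k N z) q (crt_set \<Omega> q)) \<longlongrightarrow>
      measure (vol_measure k) (\<Union>z\<in>Z. cube k N z)) (spacing_at_top \<Omega>)"
    using measure_cubes[OF assms(1-3)] by simp
  moreover have "eventually (\<lambda>q. (\<Sum>z\<in>Z. correlation k (cube k N z) q (crt_set \<Omega> q))
      = correlation k (\<Union>z\<in>Z. cube k N z) q (crt_set \<Omega> q)) (spacing_at_top \<Omega>)"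
    using eventually_spacing_at_top[of 1 \<Omega>]
    by eventually_elim (use correlation_cubes[OF assms(1-3)] in auto)
  ultimately show ?thesis by (rule Lim_transform_eventually)
qed

text \<open>Monotonicity squeezes the correlation of \<open>X\<close> between those of the inner and
  outer unions of cubes, whose limits are volumes arbitrarily close to that of
  \<open>X\<close>.\<close>

lemma correlation_tendsto:
  assumes X: "compactin (real_space k) X" "X \<subseteq> ordered_cone k" and null: "jordan_null_frontier k X"
  shows "((\<lambda>q. correlation k X q (crt_set \<Omega> q)) \<longlongrightarrow> measure (vol_measure k) X) (spacing_at_top \<Omega>)"
proof -
  define out where "out n = cube_index k (Suc n) ` X" for n
  define inn where "inn n = {z \<in> {1..<k} \<rightarrow>\<^sub>E UNIV. cube k (Suc n) z \<subseteq> X}" for n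
  define U where "U n Z = (\<Union>z\<in>Z. cube k (Suc n) z)" for n Z
  note approx = cube_approximation[OF X(1) null, folded out_def inn_def, folded U_def]
  have sub: "out n \<subseteq> {1..<k} \<rightarrow>\<^sub>E UNIV" "inn n \<subseteq> {1..<k} \<rightarrow>\<^sub>E UNIV" for n
    unfolding out_def inn_def using cube_index_in_PiE by blast+
  have fin: "finite (out n)" "finite (inn n)" for n
    using approx(1,2) finite_subset by blast+
  have XU: "X \<subseteq> U n (out n)" for n
  proof
    fix x assume "x \<in> X"
    then show "x \<in> U n (out n)"
      unfolding U_def cubes_Union_iff[OF zero_less_Suc sub(1)]
      using X(2) by (auto simp: ordered_cone_def out_def)
  qed
  have finU: "finite (dilate_lattice_points k s (U n (out n)))" if "0 < s" for s n
    unfolding U_def dilate_lattice_points_Union using fin(1) that by (auto intro: finite_dilate_cube)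
  have finX: "finite (dilate_lattice_points k s X)" if "0 < s" for s
    using finite_subset[OF dilate_lattice_points_mono[OF XU] finU[OF that]] .
  have cone: "eventually (\<lambda>n. \<forall>z\<in>out n. cube k (Suc n) z \<subseteq> ordered_cone k) sequentially"
    unfolding out_def by (rule compact_cone_cubes[OF X])
  have inn_cone: "\<forall>z\<in>inn n. cube k (Suc n) z \<subseteq> ordered_cone k" for n
    using X(2) by (auto simp: inn_def)
  have UX: "U n (inn n) \<subseteq> X" for n by (auto simp: U_def inn_def)
  show ?thesis
  proof (rule order_tendstoI)
    fix y assume "measure (vol_measure k) X < y"
    then have "eventually (\<lambda>n. measure (vol_measure k) (U n (out n)) < y) sequentially"
      by (rule order_tendstoD(2)[OF approx(3)])
    \<comment> \<open>The outer cubes lie in the cone only for fine meshes, so both requirements are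
      imposed on the same \<open>n\<close>.\<close>
    from eventually_happens[OF eventually_conj[OF this cone]] obtain n
      where n: "measure (vol_measure k) (U n (out n)) < y" "\<forall>z\<in>out n. cube k (Suc n) z \<subseteq> ordered_cone k"
      by auto
    have "((\<lambda>q. correlation k (U n (out n)) q (crt_set \<Omega> q)) \<longlongrightarrow> measure (vol_measure k) (U n (out n)))
        (spacing_at_top \<Omega>)"
      unfolding U_def using fin(1) sub(1) n(2) by (intro correlation_cubes_tendsto) auto
    from order_tendstoD(2)[OF this n(1)] eventually_spacing_at_top[of 1 \<Omega>]
    show "eventually (\<lambda>q. correlation k X q (crt_set \<Omega> q) < y) (spacing_at_top \<Omega>)"
    proof eventually_elim
      case (elim q)
      then have "correlation k X q (crt_set \<Omega> q) \<le> correlation k (U n (out n)) q (crt_set \<Omega> q)"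
        by (intro correlation_mono XU finU) auto
      with elim show ?case by simp
    qed
  next
    fix y assume "y < measure (vol_measure k) X"
    then have "eventually (\<lambda>n. y < measure (vol_measure k) (U n (inn n))) sequentially"
      by (rule order_tendstoD(1)[OF approx(4)])
    from eventually_happens[OF this] obtain n where n: "y < measure (vol_measure k) (U n (inn n))"
      by auto
    have "((\<lambda>q. correlation k (U n (inn n)) q (crt_set \<Omega> q)) \<longlongrightarrow> measure (vol_measure k) (U n (inn n)))
        (spacing_at_top \<Omega>)"
      unfolding U_def using fin(2) sub(2) inn_cone by (intro correlation_cubes_tendsto) auto
    from order_tendstoD(1)[OF this n] eventually_spacing_at_top[of 1 \<Omega>]
    show "eventually (\<lambda>q. y < correlation k X q (crt_set \<Omega> q)) (spacing_at_top \<Omega>)"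
    proof eventually_elim
      case (elim q)
      then have "correlation k (U n (inn n)) q (crt_set \<Omega> q) \<le> correlation k X q (crt_set \<Omega> q)"
        by (intro correlation_mono UX finX) auto
      with elim show ?case by simp
    qed
  qed
qed

end

section \<open>From the exponent \<open>lam K\<close> to the growth condition of order
  \<open>k\<close>\<close>

text \<open>For \<open>K = 2\<close> this is \<open>sqrt 17 \<le> 5\<close>, for
  \<open>K = 3\<close> it is \<open>1 / 3 \<le> 1 / 2\<close>, and from \<open>K = 4\<close> on it
  is an equality.\<close>

lemma lam_le:
  assumes "2 \<le> K"
  shows "lam K \<le> 1 / (real K - 1)"
proof -
  have "sqrt 17 \<le> 5" by (rule real_le_lsqrt) auto
  then show ?thesis using assms by (auto simp: lam_def)
qed

theorem theorem3p8:
  fixes \<epsilon> :: real and K :: nat and \<Omega> :: "nat \<Rightarrow> int set"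
  assumes "\<epsilon> > 0" and "K \<ge> 2"
    and "\<And>p. prime p \<Longrightarrow> \<Omega> p \<noteq> {} \<and> \<Omega> p \<subseteq> {0..<int p}"
    and "\<exists>C. \<forall>p. prime p \<longrightarrow> spacing p (\<Omega> p) \<le> C * real p powr (lam K - \<epsilon>)"
    and "\<forall>k\<in>{2..K}. \<exists>C. \<forall>p (h :: nat \<Rightarrow> int). prime p \<longrightarrow>
           inj_on (\<lambda>i. (h(0 := 0)) i mod int p) {..<k} \<longrightarrow>
           (\<exists>E. real (shift_count k h p (\<Omega> p)) =
                  (1 / spacing p (\<Omega> p)) ^ k * real p * (1 + E) \<and>
                \<bar>E\<bar> \<le> C * (1 - 1 / spacing p (\<Omega> p)) * real p powr (- \<epsilon>))"
  shows "\<forall>k\<in>{2..K}. \<forall>X. compactin (real_space k) X \<and> X \<subseteq> ordered_cone k \<and>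
           jordan_null_frontier k X \<longrightarrow>
           ((\<lambda>q. correlation k X q (crt_set \<Omega> q)) \<longlongrightarrow> measure (vol_measure k) X)
             (spacing_at_top \<Omega>)"
proof (intro ballI allI impI)
  fix k X
  assume k: "k \<in> {2..K}"
    and X: "compactin (real_space k) X \<and> X \<subseteq> ordered_cone k \<and> jordan_null_frontier k X"
  interpret residue_sets \<Omega> by unfold_locales (rule assms(3))
  obtain C\<^sub>0 where C\<^sub>0: "\<And>p. prime p \<Longrightarrow> \<sigma> p \<le> C\<^sub>0 * real p powr (lam K - \<epsilon>)"
    using assms(4) by blast
  obtain c where c: "\<And>m p h. m \<in> {2..K} \<Longrightarrow> prime p \<Longrightarrow> inj_on (\<lambda>i. (h(0 := 0)) i mod int p) {..<m} \<Longrightarrow>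
      \<exists>E. real (shift_count m h p (\<Omega> p)) = (1 / \<sigma> p) ^ m * real p * (1 + E)
        \<and> \<bar>E\<bar> \<le> c m * (1 - 1 / \<sigma> p) * real p powr (- \<epsilon>)"
    using assms(5) by metis
  \<comment> \<open>One nonnegative constant for all orders at once.\<close>
  define C where "C = (\<Sum>m\<in>{2..K}. \<bar>c m\<bar>)"
  have growth: "\<sigma> p ^ (k - 1) \<le> C\<^sub>0 ^ (k - 1) * real p powr (1 - \<epsilon>)" if p: "prime p" for p
  proof -
    have p1: "1 \<le> real p" using prime_ge_1_nat[OF p] by simp
    have "0 < C\<^sub>0 * real p powr (lam K - \<epsilon>)" using C\<^sub>0[OF p] spacing_bounds(1)[OF p] by linarith
    then have pos: "0 < C\<^sub>0" using p1 by (simp add: zero_less_mult_iff)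
    \<comment> \<open>Since \<open>k \<le> K\<close>, the exponent \<open>lam K\<close> contributes
      at most \<open>1\<close>; the term \<open>\<epsilon>\<close> is multiplied by
      \<open>k - 1 \<ge> 1\<close>, so at least \<open>\<epsilon>\<close> is saved.\<close>
    have "lam K * real (k - 1) \<le> 1 / (real K - 1) * (real K - 1)"
      using lam_le[OF assms(2)] k by (intro mult_mono) (auto simp: of_nat_diff)
    also have "\<dots> = 1" using assms(2) by simp
    finally have "(lam K - \<epsilon>) * real (k - 1) \<le> 1 - \<epsilon> * real (k - 1)" by (simp add: algebra_simps)
    also have "\<dots> \<le> 1 - \<epsilon>" using assms(1) k by simp
    finally have exponent: "(lam K - \<epsilon>) * real (k - 1) \<le> 1 - \<epsilon>" .
    have "\<sigma> p ^ (k - 1) \<le> (C\<^sub>0 * real p powr (lam K - \<epsilon>)) ^ (k - 1)"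
      using C\<^sub>0[OF p] spacing_bounds(1)[OF p] by (intro power_mono) auto
    also have "\<dots> = C\<^sub>0 ^ (k - 1) * real p powr ((lam K - \<epsilon>) * real (k - 1))"
      using p1 by (simp add: power_mult_distrib powr_realpow[symmetric] powr_powr)
    also have "\<dots> \<le> C\<^sub>0 ^ (k - 1) * real p powr (1 - \<epsilon>)"
      using exponent p1 pos by (intro mult_left_mono powr_mono) auto
    finally show ?thesis .
  qed
  interpret poisson_family \<Omega> k \<epsilon> "C\<^sub>0 ^ (k - 1)" C
  proof unfold_locales
    show "2 \<le> k" "0 < \<epsilon>" "0 \<le> C" using k assms(1) by (auto simp: C_def intro: sum_nonneg)
    show "\<sigma> p ^ (k - 1) \<le> C\<^sub>0 ^ (k - 1) * real p powr (1 - \<epsilon>)" if "prime p" for p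
      using that by (rule growth)
    show "\<bar>excess \<Omega> m h p\<bar> \<le> C * (1 - 1 / \<sigma> p) * real p powr (- \<epsilon>)"
      if m: "2 \<le> m" "m \<le> k" and p: "prime p" and inj: "inj_on (\<lambda>i. (h(0 := 0)) i mod int p) {..<m}" for m p h
    proof -
      have mK: "m \<in> {2..K}" using m k by auto
      obtain E where E: "real (shift_count m h p (\<Omega> p)) = (1 / \<sigma> p) ^ m * real p * (1 + E)"
        "\<bar>E\<bar> \<le> c m * (1 - 1 / \<sigma> p) * real p powr (- \<epsilon>)"
        using c[OF mK p inj] by blast
      \<comment> \<open>The equation determines the error term, because the main term is
        nonzero.\<close>
      have "excess \<Omega> m h p = E"
        using spacing_bounds(1)[OF p] prime_gt_0_nat[OF p] by (simp add: excess_def E(1) power_one_over)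
      moreover have "\<bar>c m\<bar> \<le> C"
        unfolding C_def using mK by (intro member_le_sum) auto
      then have "c m \<le> C" by simp
      then have "c m * (1 - 1 / \<sigma> p) * real p powr (- \<epsilon>) \<le> C * (1 - 1 / \<sigma> p) * real p powr (- \<epsilon>)"
        using spacing_bounds(1)[OF p] by (intro mult_right_mono) auto
      ultimately show ?thesis using E(2) by simp
    qed
  qed
  show "((\<lambda>q. correlation k X q (crt_set \<Omega> q)) \<longlongrightarrow> measure (vol_measure k) X) (spacing_at_top \<Omega>)"
    using X by (intro correlation_tendsto) auto
qed

end
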